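(* Let $(V,E)$ be a finite nonempty directed acyclic graph with swept edges $E_S\subset E$, source $V_S$ and sink $V_T$, let $w_i>0$ ($i\in V$) and $W_K>0$ be real weights, and consider the integer program $$\min\; W_K K+\sum_{i\in V} w_i(d_i-c_i)$$ over integers $K$ and $c_i,d_i,e_i$ ($i\in V$), subject to: $c_i=1$ for $i\in V_S$; $d_i-K=0$ for $i\in V_T$; $c_i-d_i\le 0$, $\;c_i-e_i\le -I_{\exists (j,i)\in E_S}$, $\;e_i-c_i\le 1$ for $i\in V$; $c_i-c_j\le 0$, $\;c_j-d_i\le 0$, $\;e_i-e_j\le -I_{(i,j)\in E_S}$ for $(i,j)\in E$. Then: (a) The constraint matrix of this program is totally unimodular, and the integer program can be solved by solving its linear programming relaxation (the same program with real variables): every optimal basic (vertex) solution of the relaxation is integral, hence an optimal solution of the integer program. (b) The linear programming dual of the relaxation is the following problem: choose $x_{c_i,0}\in\mathbb{R}$ for $i\in V_S$; $x_{d_i,K}\in\mathbb{R}$ for $i\in V_T$; $x_{c_i,d_i},x_{c_i,e_i},x_{e_i,c_i}\ge 0$ for $i\in V$; $x_{c_i,c_j},x_{c_j,d_i},x_{e_i,e_j}\ge 0$ for $(i,j)\in E$, in order to $$\min\; \sum_{i\in V_S}x_{c_i,0}+\sum_{i\in V}\bigl(x_{e_i,c_i}-I_{\exists (j,i)\in E_S}\,x_{c_i,e_i}\bigr)-\sum_{(i,j)\in E_S}x_{e_i,e_j}$$ subject to $\sum_{i\in V_T}x_{d_i,K}=W_K$ and, for all $i\in V$, $$I_{i\in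 V_S}x_{c_i,0}+x_{c_i,d_i}+x_{c_i,e_i}-x_{e_i,c_i}+\sum_{j:(j,i)\in E}(x_{c_i,d_j}-x_{c_j,c_i})+\sum_{j:(i,j)\in E}x_{c_i,c_j}=w_i,$$ $$I_{i\in V_T}x_{d_i,K}-x_{c_i,d_i}-\sum_{j:(i,j)\in E}x_{c_j,d_i}=-w_i,$$ $$-x_{c_i,e_i}+x_{e_i,c_i}+\sum_{j:(i,j)\in E}x_{e_i,e_j}-\sum_{j:(j,i)\in E}x_{e_j,e_i}=0.$$ (c) The equation $\sum_{i\in V_S}x_{c_i,0}=-W_K$ is a linear combination of the equality constraints in (b); adding it, the problem in (b) is a minimum-cost network flow problem on the network whose nodes are $0$, $K$ and $c_i,d_i,e_i$ ($i\in V$), with one arc from $a$ to $b$ for each variable $x_{a,b}$, the equality constraints being the flow balance equations at all the nodes.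
   Context: $(V,E)$ is a finite directed acyclic graph and $E_S\subset E$ is a distinguished set of edges, called swept edges. The source $V_S$ is the set of vertices with no incoming edge and the sink $V_T$ is the set of vertices with no outgoing edge. $I_P$ equals $1$ if the condition $P$ holds and $0$ otherwise; in particular $I_{\exists (j,i)\in E_S}=1$ if vertex $i$ has an incoming swept edge and $0$ otherwise. The integer program encodes the search for an optimal decomposition of the graph into $K$ stages, where $c_i,d_i,e_i$ are integers attached to vertex $i$ (creating stage, discarding stage, effective stage); $w_i$ is the weight (data size) of vertex $i$ and $W_K$ is a positive weight on the number of stages. Convention for the dual: for a linear program $\min\{\gamma^T y: Ay\le b,\ By=g\}$ with $y$ real and unrestricted in sign, the dual is written (with its objective negated, so that it is a minimization) as $\min\{b^Tx+g^Tz: A^Tx+B^Tz=-\gamma,\ x\ge 0,\ z \text{ free}\}$. In a network flow problem, the flow balance equation at a node states that the total flow on arcs leaving the node minus the total flow on arcs entering the node equals a prescribed supply at that node; the flow $x_{a,b}$ on some arcs (here those for $i\in V_S$, $i\in V_T$) may be unrestricted in sign, and on the other arcs is nonnegative. *)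

theory Defs
  imports "Jordan_Normal_Form.Determinant" "Graph_Theory.Digraph"
begin

section \<open>Linear programs\<close>

text \<open>
  The linear program \<open>min \<gamma>\<^sup>T y\<close> subject to \<open>A y \<le> b\<close>, \<open>B y = g\<close> with \<open>y\<close> of free sign.
  The variables are indexed by \<open>lp_vars\<close>, the rows of \<open>A\<close> by \<open>lp_ineqs\<close>, the rows of \<open>B\<close> by
  \<open>lp_eqs\<close>; \<open>A\<close> and \<open>B\<close> are stacked into the single matrix \<open>lp_mat\<close>, \<open>b\<close> and \<open>g\<close> into \<open>lp_rhs\<close>,
  so the two sets of row indices are meant to be disjoint.  Values outside the index sets are
  irrelevant.
\<close>

record ('r, 'c) lp =
  lp_vars :: "'c set"
  lp_ineqs :: "'r set"
  lp_eqs :: "'r set"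
  lp_mat :: "'r \<Rightarrow> 'c \<Rightarrow> real"
  lp_rhs :: "'r \<Rightarrow> real"
  lp_cost :: "'c \<Rightarrow> real"

definition lp_lhs :: "('r, 'c) lp \<Rightarrow> ('c \<Rightarrow> real) \<Rightarrow> 'r \<Rightarrow> real" where
  "lp_lhs P y r = (\<Sum>j\<in>lp_vars P. lp_mat P r j * y j)"

definition lp_objective :: "('r, 'c) lp \<Rightarrow> ('c \<Rightarrow> real) \<Rightarrow> real" where
  "lp_objective P y = (\<Sum>j\<in>lp_vars P. lp_cost P j * y j)"

definition lp_feasible :: "('r, 'c) lp \<Rightarrow> ('c \<Rightarrow> real) \<Rightarrow> bool" where
  "lp_feasible P y \<longleftrightarrow>
     (\<forall>r\<in>lp_ineqs P. lp_lhs P y r \<le> lp_rhs P r) \<and> (\<forall>r\<in>lp_eqs P. lp_lhs P y r = lp_rhs P r)"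

definition lp_optimal :: "('r, 'c) lp \<Rightarrow> ('c \<Rightarrow> real) \<Rightarrow> bool" where
  "lp_optimal P y \<longleftrightarrow>
     lp_feasible P y \<and> (\<forall>z. lp_feasible P z \<longrightarrow> lp_objective P y \<le> lp_objective P z)"

definition lp_integral :: "('r, 'c) lp \<Rightarrow> ('c \<Rightarrow> real) \<Rightarrow> bool" where
  "lp_integral P y \<longleftrightarrow> (\<forall>j\<in>lp_vars P. y j \<in> \<int>)"

definition ip_optimal :: "('r, 'c) lp \<Rightarrow> ('c \<Rightarrow> real) \<Rightarrow> bool" where
  "ip_optimal P y \<longleftrightarrow>
     lp_feasible P y \<and> lp_integral P y \<and>
     (\<forall>z. lp_feasible P z \<and> lp_integral P z \<longrightarrow> lp_objective P y \<le> lp_objective P z)"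

definition lp_active :: "('r, 'c) lp \<Rightarrow> ('c \<Rightarrow> real) \<Rightarrow> 'r set" where
  "lp_active P y = {r \<in> lp_ineqs P \<union> lp_eqs P. lp_lhs P y r = lp_rhs P r}"

definition lp_rows_independent :: "('r, 'c) lp \<Rightarrow> 'r set \<Rightarrow> bool" where
  "lp_rows_independent P I \<longleftrightarrow>
     (\<forall>u. (\<forall>j\<in>lp_vars P. (\<Sum>r\<in>I. u r * lp_mat P r j) = 0) \<longrightarrow> (\<forall>r\<in>I. u r = 0))"

text \<open>
  A basic feasible solution (a vertex of the feasible polyhedron): as many linearly independent
  constraints are active at \<open>y\<close> as there are variables.
\<close>

definition lp_basic :: "('r, 'c) lp \<Rightarrow> ('c \<Rightarrow> real) \<Rightarrow> bool" where
  "lp_basic P y \<longleftrightarrow>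
     lp_feasible P y \<and>
     (\<exists>I \<subseteq> lp_active P y. finite I \<and> card I = card (lp_vars P) \<and> lp_rows_independent P I)"

text \<open>
  The dual, with negated objective: \<open>min b\<^sup>T x + g\<^sup>T z\<close> subject to \<open>A\<^sup>T x + B\<^sup>T z = -\<gamma>\<close>, \<open>x \<ge> 0\<close>,
  \<open>z\<close> free.  Here \<open>x\<close> and \<open>z\<close> are the restrictions of one function to \<open>lp_ineqs\<close> and \<open>lp_eqs\<close>.
\<close>

definition lp_dual_feasible :: "('r, 'c) lp \<Rightarrow> ('r \<Rightarrow> real) \<Rightarrow> bool" where
  "lp_dual_feasible P x \<longleftrightarrow>
     (\<forall>r\<in>lp_ineqs P. 0 \<le> x r) \<and>
     (\<forall>j\<in>lp_vars P.
        (\<Sum>r\<in>lp_ineqs P. lp_mat P r j * x r) + (\<Sum>r\<in>lp_eqs P. lp_mat P r j * x r) = - lp_cost P j)"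

definition lp_dual_objective :: "('r, 'c) lp \<Rightarrow> ('r \<Rightarrow> real) \<Rightarrow> real" where
  "lp_dual_objective P x =
     (\<Sum>r\<in>lp_ineqs P. lp_rhs P r * x r) + (\<Sum>r\<in>lp_eqs P. lp_rhs P r * x r)"

definition totally_unimodular :: "'r set \<Rightarrow> 'c set \<Rightarrow> ('r \<Rightarrow> 'c \<Rightarrow> real) \<Rightarrow> bool" where
  "totally_unimodular R C A \<longleftrightarrow>
     (\<forall>k f g. inj_on f {..<k} \<and> f ` {..<k} \<subseteq> R \<and> inj_on g {..<k} \<and> g ` {..<k} \<subseteq> C \<longrightarrow>
        det (mat k k (\<lambda>(i, j). A (f i) (g j))) \<in> {-1, 0, 1})"

section \<open>Minimum-cost network flows\<close>

definition flow_balance :: "('n, 'a) pre_digraph \<Rightarrow> ('n \<Rightarrow> real) \<Rightarrow> ('a \<Rightarrow> real) \<Rightarrow> 'n \<Rightarrow> bool" where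
  "flow_balance G supply x n \<longleftrightarrow>
     (\<Sum>a\<in>out_arcs G n. x a) - (\<Sum>a\<in>in_arcs G n. x a) = supply n"

text \<open>The flow on the arcs in \<open>F\<close> is unrestricted in sign.\<close>

definition flow_feasible ::
    "('n, 'a) pre_digraph \<Rightarrow> ('n \<Rightarrow> real) \<Rightarrow> 'a set \<Rightarrow> ('a \<Rightarrow> real) \<Rightarrow> bool" where
  "flow_feasible G supply F x \<longleftrightarrow>
     (\<forall>n\<in>verts G. flow_balance G supply x n) \<and> (\<forall>a\<in>arcs G - F. 0 \<le> x a)"

definition flow_cost :: "('n, 'a) pre_digraph \<Rightarrow> ('a \<Rightarrow> real) \<Rightarrow> ('a \<Rightarrow> real) \<Rightarrow> real" where
  "flow_cost G cost x = (\<Sum>a\<in>arcs G. cost a * x a)"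

section \<open>The stage program\<close>

definition source :: "'v set \<Rightarrow> ('v \<times> 'v) set \<Rightarrow> 'v set" where
  "source V E = {i \<in> V. \<not> (\<exists>j. (j, i) \<in> E)}"

definition sink :: "'v set \<Rightarrow> ('v \<times> 'v) set \<Rightarrow> 'v set" where
  "sink V E = {i \<in> V. \<not> (\<exists>j. (i, j) \<in> E)}"

text \<open>
  The names \<open>K\<close>, \<open>c\<^sub>i\<close>, \<open>d\<^sub>i\<close>, \<open>e\<^sub>i\<close> of the primal variables, together with the extra node \<open>0\<close> of the
  network.
\<close>

datatype 'v node = N0 | NK | NC 'v | ND 'v | NE 'v

definition stage_vars :: "'v set \<Rightarrow> 'v node set" where
  "stage_vars V = {NK} \<union> NC ` V \<union> ND ` V \<union> NE ` V"

text \<open>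
  Every constraint bounds a difference \<open>a - b\<close> and is indexed by the pair \<open>(a, b)\<close>, as its
  dual variable \<open>x\<^bsub>a,b\<^esub>\<close> is; \<open>c\<^sub>i = 1\<close> is read as \<open>c\<^sub>i - 0 = 1\<close>.  Acyclicity of \<open>E\<close> keeps the
  indices \<open>(c\<^sub>i, d\<^sub>i)\<close> of \<open>c\<^sub>i - d\<^sub>i \<le> 0\<close> apart from the indices \<open>(c\<^sub>j, d\<^sub>i)\<close> of \<open>c\<^sub>j - d\<^sub>i \<le> 0\<close>.
\<close>

definition stage_eqs :: "'v set \<Rightarrow> ('v \<times> 'v) set \<Rightarrow> ('v node \<times> 'v node) set" where
  "stage_eqs V E =
     {(NC i, N0) |i. i \<in> source V E} \<union> {(ND i, NK) |i. i \<in> sink V E}"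

definition stage_ineqs :: "'v set \<Rightarrow> ('v \<times> 'v) set \<Rightarrow> ('v node \<times> 'v node) set" where
  "stage_ineqs V E =
     {(NC i, ND i) |i. i \<in> V} \<union> {(NC i, NE i) |i. i \<in> V} \<union> {(NE i, NC i) |i. i \<in> V} \<union>
     {(NC i, NC j) |i j. (i, j) \<in> E} \<union> {(NC j, ND i) |i j. (i, j) \<in> E} \<union>
     {(NE i, NE j) |i j. (i, j) \<in> E}"

fun stage_rhs :: "('v \<times> 'v) set \<Rightarrow> 'v node \<times> 'v node \<Rightarrow> real" where
  "stage_rhs ES (NC i, N0) = 1"
| "stage_rhs ES (NC i, NE i') = - of_bool (\<exists>j. (j, i) \<in> ES)"
| "stage_rhs ES (NE i, NC i') = 1"
| "stage_rhs ES (NE i, NE j) = - of_bool ((i, j) \<in> ES)"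
| "stage_rhs ES _ = 0"

fun stage_cost :: "('v \<Rightarrow> real) \<Rightarrow> real \<Rightarrow> 'v node \<Rightarrow> real" where
  "stage_cost w WK NK = WK"
| "stage_cost w WK (NC i) = - w i"
| "stage_cost w WK (ND i) = w i"
| "stage_cost w WK _ = 0"

definition stage_lp ::
    "'v set \<Rightarrow> ('v \<times> 'v) set \<Rightarrow> ('v \<times> 'v) set \<Rightarrow> ('v \<Rightarrow> real) \<Rightarrow> real
      \<Rightarrow> ('v node \<times> 'v node, 'v node) lp" where
  "stage_lp V E ES w WK =
     \<lparr>lp_vars = stage_vars V,
      lp_ineqs = stage_ineqs V E,
      lp_eqs = stage_eqs V E,
      lp_mat = (\<lambda>(a, b) v. of_bool (v = a) - of_bool (v = b)),
      lp_rhs = stage_rhs ES,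
      lp_cost = stage_cost w WK\<rparr>"

lemma stage_lp_simps [simp]:
  "lp_vars (stage_lp V E ES w WK) = stage_vars V"
  "lp_ineqs (stage_lp V E ES w WK) = stage_ineqs V E"
  "lp_eqs (stage_lp V E ES w WK) = stage_eqs V E"
  "lp_mat (stage_lp V E ES w WK) = (\<lambda>(a, b) v. of_bool (v = a) - of_bool (v = b))"
  "lp_rhs (stage_lp V E ES w WK) = stage_rhs ES"
  "lp_cost (stage_lp V E ES w WK) = stage_cost w WK"
  by (simp_all add: stage_lp_def)

lemma finite_stage_vars [simp]: "finite V \<Longrightarrow> finite (stage_vars V)"
  by (simp add: stage_vars_def)

lemma stage_lp_lhs:
  assumes "finite V"
  shows "lp_lhs (stage_lp V E ES w WK) y (a, b) =
    (if a \<in> stage_vars V then y a else 0) - (if b \<in> stage_vars V then y b else 0)"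
proof -
  have "of_bool (v = u) * y v = (if v = u then y v else 0)" for u v
    by simp
  then show ?thesis
    using assms by (simp add: lp_lhs_def left_diff_distrib sum_subtractf sum.delta)
qed

text \<open>The stage program written out as inequalities and equations in \<open>K\<close>, \<open>c\<close>, \<open>d\<close>, \<open>e\<close>.\<close>

lemma stage_lp_feasible_iff:
  assumes "finite V" "E \<subseteq> V \<times> V"
  shows "lp_feasible (stage_lp V E ES w WK) y \<longleftrightarrow>
    (let K = y NK; c = (\<lambda>i. y (NC i)); d = (\<lambda>i. y (ND i)); e = (\<lambda>i. y (NE i)) in
      (\<forall>i\<in>source V E. c i = 1) \<and>
      (\<forall>i\<in>sink V E. d i - K = 0) \<and>
      (\<forall>i\<in>V. c i - d i \<le> 0 \<and> c i - e i \<le> - of_bool (\<exists>j. (j, i) \<in> ES) \<and> e i - c i \<le> 1) \<and>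
      (\<forall>(i, j)\<in>E. c i - c j \<le> 0 \<and> c j - d i \<le> 0 \<and> e i - e j \<le> - of_bool ((i, j) \<in> ES)))"
proof -
  let ?P = "stage_lp V E ES w WK"
  have mem: "NK \<in> stage_vars V" "N0 \<notin> stage_vars V"
    "NC i \<in> stage_vars V \<longleftrightarrow> i \<in> V" "ND i \<in> stage_vars V \<longleftrightarrow> i \<in> V"
    "NE i \<in> stage_vars V \<longleftrightarrow> i \<in> V" for i
    by (auto simp: stage_vars_def)
  have sub: "source V E \<subseteq> V" "sink V E \<subseteq> V"
    by (auto simp: source_def sink_def)
  have eqs: "(\<forall>r\<in>stage_eqs V E. lp_lhs ?P y r = stage_rhs ES r) \<longleftrightarrow>
      (\<forall>i\<in>source V E. y (NC i) = 1) \<and> (\<forall>i\<in>sink V E. y (ND i) - y NK = 0)"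
  proof -
    have "(\<forall>r\<in>stage_eqs V E. lp_lhs ?P y r = stage_rhs ES r) \<longleftrightarrow>
        (\<forall>i\<in>source V E. lp_lhs ?P y (NC i, N0) = stage_rhs ES (NC i, N0)) \<and>
        (\<forall>i\<in>sink V E. lp_lhs ?P y (ND i, NK) = stage_rhs ES (ND i, NK))"
      unfolding stage_eqs_def by blast
    then show ?thesis
      using sub by (simp add: stage_lp_lhs[OF assms(1)] mem subset_iff)
  qed
  have ineqs: "(\<forall>r\<in>stage_ineqs V E. lp_lhs ?P y r \<le> stage_rhs ES r) \<longleftrightarrow>
      (\<forall>i\<in>V. lp_lhs ?P y (NC i, ND i) \<le> stage_rhs ES (NC i, ND i) \<and>
             lp_lhs ?P y (NC i, NE i) \<le> stage_rhs ES (NC i, NE i) \<and>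
             lp_lhs ?P y (NE i, NC i) \<le> stage_rhs ES (NE i, NC i)) \<and>
      (\<forall>(i, j)\<in>E. lp_lhs ?P y (NC i, NC j) \<le> stage_rhs ES (NC i, NC j) \<and>
             lp_lhs ?P y (NC j, ND i) \<le> stage_rhs ES (NC j, ND i) \<and>
             lp_lhs ?P y (NE i, NE j) \<le> stage_rhs ES (NE i, NE j))"
    unfolding stage_ineqs_def by blast
  have "(\<forall>(i, j)\<in>E. lp_lhs ?P y (NC i, NC j) \<le> stage_rhs ES (NC i, NC j) \<and>
             lp_lhs ?P y (NC j, ND i) \<le> stage_rhs ES (NC j, ND i) \<and>
             lp_lhs ?P y (NE i, NE j) \<le> stage_rhs ES (NE i, NE j)) \<longleftrightarrow>
      (\<forall>(i, j)\<in>E. y (NC i) - y (NC j) \<le> 0 \<and> y (NC j) - y (ND i) \<le> 0 \<and>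
             y (NE i) - y (NE j) \<le> - of_bool ((i, j) \<in> ES))"
    using assms(2) by (intro ball_cong) (auto simp: stage_lp_lhs[OF assms(1)] mem)
  moreover have "(\<forall>i\<in>V. lp_lhs ?P y (NC i, ND i) \<le> stage_rhs ES (NC i, ND i) \<and>
             lp_lhs ?P y (NC i, NE i) \<le> stage_rhs ES (NC i, NE i) \<and>
             lp_lhs ?P y (NE i, NC i) \<le> stage_rhs ES (NE i, NC i)) \<longleftrightarrow>
      (\<forall>i\<in>V. y (NC i) - y (ND i) \<le> 0 \<and>
             y (NC i) - y (NE i) \<le> - of_bool (\<exists>j. (j, i) \<in> ES) \<and> y (NE i) - y (NC i) \<le> 1)"
    by (intro ball_cong) (auto simp: stage_lp_lhs[OF assms(1)] mem)
  ultimately show ?thesis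
    unfolding lp_feasible_def Let_def stage_lp_simps eqs ineqs by argo
qed

lemma stage_lp_objective:
  assumes "finite V"
  shows "lp_objective (stage_lp V E ES w WK) y =
    WK * y NK + (\<Sum>i\<in>V. w i * (y (ND i) - y (NC i)))"
proof -
  let ?f = "\<lambda>v. stage_cost w WK v * y v"
  have "sum ?f (stage_vars V) = ?f NK + sum ?f (NC ` V) + sum ?f (ND ` V) + sum ?f (NE ` V)"
  proof -
    have "sum ?f (stage_vars V) = sum ?f ({NK} \<union> NC ` V \<union> ND ` V) + sum ?f (NE ` V)"
      unfolding stage_vars_def using assms by (intro sum.union_disjoint) auto
    moreover have "sum ?f ({NK} \<union> NC ` V \<union> ND ` V) = sum ?f ({NK} \<union> NC ` V) + sum ?f (ND ` V)"
      using assms by (intro sum.union_disjoint) auto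
    moreover have "sum ?f ({NK} \<union> NC ` V) = sum ?f {NK} + sum ?f (NC ` V)"
      using assms by (intro sum.union_disjoint) auto
    ultimately show ?thesis
      by simp
  qed
  then show ?thesis
    by (simp add: lp_objective_def sum.reindex inj_on_def sum_negf sum_subtractf right_diff_distrib)
qed

section \<open>The flow form of the dual\<close>

text \<open>
  The equality constraints, one for each primal variable; the equation at \<open>N0\<close> is the one to be
  added in the passage to a network flow problem.
\<close>

fun stage_eq_lhs :: "'v set \<Rightarrow> ('v \<times> 'v) set \<Rightarrow> ('v node \<times> 'v node \<Rightarrow> real) \<Rightarrow> 'v node \<Rightarrow> real" where
  "stage_eq_lhs V E x N0 = (\<Sum>i\<in>source V E. x (NC i, N0))"
| "stage_eq_lhs V E x NK = (\<Sum>i\<in>sink V E. x (ND i, NK))"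
| "stage_eq_lhs V E x (NC i) =
     of_bool (i \<in> source V E) * x (NC i, N0) + x (NC i, ND i) + x (NC i, NE i) - x (NE i, NC i)
     + (\<Sum>j | (j, i) \<in> E. x (NC i, ND j) - x (NC j, NC i)) + (\<Sum>j | (i, j) \<in> E. x (NC i, NC j))"
| "stage_eq_lhs V E x (ND i) =
     of_bool (i \<in> sink V E) * x (ND i, NK) - x (NC i, ND i) - (\<Sum>j | (i, j) \<in> E. x (NC j, ND i))"
| "stage_eq_lhs V E x (NE i) =
     - x (NC i, NE i) + x (NE i, NC i) + (\<Sum>j | (i, j) \<in> E. x (NE i, NE j))
     - (\<Sum>j | (j, i) \<in> E. x (NE j, NE i))"

fun stage_eq_rhs :: "('v \<Rightarrow> real) \<Rightarrow> real \<Rightarrow> 'v node \<Rightarrow> real" where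
  "stage_eq_rhs w WK N0 = - WK"
| "stage_eq_rhs w WK NK = WK"
| "stage_eq_rhs w WK (NC i) = w i"
| "stage_eq_rhs w WK (ND i) = - w i"
| "stage_eq_rhs w WK (NE i) = 0"

definition stage_dual_nonneg :: "'v set \<Rightarrow> ('v \<times> 'v) set \<Rightarrow> ('v node \<times> 'v node \<Rightarrow> real) \<Rightarrow> bool" where
  "stage_dual_nonneg V E x \<longleftrightarrow>
     (\<forall>i\<in>V. 0 \<le> x (NC i, ND i) \<and> 0 \<le> x (NC i, NE i) \<and> 0 \<le> x (NE i, NC i)) \<and>
     (\<forall>(i, j)\<in>E. 0 \<le> x (NC i, NC j) \<and> 0 \<le> x (NC j, ND i) \<and> 0 \<le> x (NE i, NE j))"

definition stage_dual_feasible ::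
    "'v set \<Rightarrow> ('v \<times> 'v) set \<Rightarrow> ('v \<Rightarrow> real) \<Rightarrow> real \<Rightarrow> ('v node \<times> 'v node \<Rightarrow> real) \<Rightarrow> bool" where
  "stage_dual_feasible V E w WK x \<longleftrightarrow>
     stage_dual_nonneg V E x \<and>
     stage_eq_lhs V E x NK = stage_eq_rhs w WK NK \<and>
     (\<forall>i\<in>V. stage_eq_lhs V E x (NC i) = stage_eq_rhs w WK (NC i) \<and>
            stage_eq_lhs V E x (ND i) = stage_eq_rhs w WK (ND i) \<and>
            stage_eq_lhs V E x (NE i) = stage_eq_rhs w WK (NE i))"

definition stage_dual_objective ::
    "'v set \<Rightarrow> ('v \<times> 'v) set \<Rightarrow> ('v \<times> 'v) set \<Rightarrow> ('v node \<times> 'v node \<Rightarrow> real) \<Rightarrow> real" where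
  "stage_dual_objective V E ES x =
     (\<Sum>i\<in>source V E. x (NC i, N0))
     + (\<Sum>i\<in>V. x (NE i, NC i) - of_bool (\<exists>j. (j, i) \<in> ES) * x (NC i, NE i))
     - (\<Sum>(i, j)\<in>ES. x (NE i, NE j))"

definition stage_network :: "'v set \<Rightarrow> ('v \<times> 'v) set \<Rightarrow> ('v node, 'v node \<times> 'v node) pre_digraph" where
  "stage_network V E =
     \<lparr>verts = {N0, NK} \<union> NC ` V \<union> ND ` V \<union> NE ` V,
      arcs = stage_eqs V E \<union> stage_ineqs V E, tail = fst, head = snd\<rparr>"

text \<open>At \<open>0\<close> and \<open>K\<close>, which only have incoming arcs, the balance is the negated equation.\<close>

fun stage_supply :: "('v \<Rightarrow> real) \<Rightarrow> real \<Rightarrow> 'v node \<Rightarrow> real" where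
  "stage_supply w WK N0 = WK"
| "stage_supply w WK NK = - WK"
| "stage_supply w WK (NC i) = w i"
| "stage_supply w WK (ND i) = - w i"
| "stage_supply w WK (NE i) = 0"

end

theory Submission
  imports Defs
begin

text \<open>
  Every constraint bounds a difference of two potentials, so the matrix is a directed incidence
  matrix with the column of the node \<open>0\<close> removed.  Expanding a subdeterminant along a row with a
  single nonzero entry, or noting that all row sums vanish, gives total unimodularity.

  Rounding a feasible point down after a common shift \<open>t \<in> [0, 1)\<close> preserves feasibility, and
  averaging over \<open>t\<close> gives back the point; hence integral optima are optimal for the relaxation.
  Since the sublevel sets are bounded, integral optima exist.  One with the largest coordinate sum is
  basic: otherwise the variables not connected to \<open>0\<close> by active constraints could be raised by \<open>1\<close>.

  The dual equations are the flow balances of the network, whose total is zero.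
\<close>

section \<open>Incidence matrices\<close>

definition incidence :: "'n \<times> 'n \<Rightarrow> 'n \<Rightarrow> real" where
  "incidence = (\<lambda>(a, b) v. of_bool (v = a) - of_bool (v = b))"

lemma sum_incidence:
  assumes "finite C"
  shows "(\<Sum>v\<in>C. incidence (a, b) v * h v) =
    (if a \<in> C then h a else 0) - (if b \<in> C then h b else 0)"
proof -
  have "of_bool (v = u) * h v = (if v = u then h v else 0)" for u v
    by simp
  then show ?thesis
    using assms by (simp add: incidence_def left_diff_distrib sum_subtractf sum.delta)
qed

lemma det_incidence:
  assumes "inj_on g {..<k}"
  shows "det (mat k k (\<lambda>(i, j). incidence (f i) (g j))) \<in> {-1, 0, 1}"
  using assms
proof (induction k arbitrary: f g)
  case 0
  then show ?case
    by (simp add: det_dim_zero)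
next
  case (Suc k)
  define M where "M = mat (Suc k) (Suc k) (\<lambda>(i, j). incidence (f i) (g j))"
  have M: "M \<in> carrier_mat (Suc k) (Suc k)"
    by (simp add: M_def)
  show ?case
  \<comment> \<open>The case split asks whether some row has at most one nonzero entry; a loop,
    where both endpoints agree, gives a zero row and lands here too.\<close>
  proof (cases "\<exists>i<Suc k. \<exists>j<Suc k. \<forall>j'<Suc k. j' \<noteq> j \<longrightarrow> M $$ (i, j') = 0")
    case True
    then obtain i j where i: "i < Suc k" and j: "j < Suc k"
      and 0: "\<And>j'. j' < Suc k \<Longrightarrow> j' \<noteq> j \<Longrightarrow> M $$ (i, j') = 0"
      by blast
    \<comment> \<open>\<open>insert_index j\<close> skips the position \<open>j\<close>, so deleting
      a row and a column only reindexes \<open>f\<close> and \<open>g\<close>, and the minor is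
      again of the form covered by the induction hypothesis.\<close>
    have "inj_on (g \<circ> insert_index j) {..<k}"
    proof (rule comp_inj_on)
      show "inj_on (insert_index j) {..<k}"
        by (rule insert_index_inj_on)
      show "inj_on g (insert_index j ` {..<k})"
        by (rule inj_on_subset[OF Suc.prems]) (auto simp: insert_index_def)
    qed
    then have "det (mat k k (\<lambda>(a, b). incidence ((f \<circ> insert_index i) a) ((g \<circ> insert_index j) b)))
        \<in> {-1, 0, 1}"
      by (rule Suc.IH)
    moreover have "mat_delete M i j =
        mat k k (\<lambda>(a, b). incidence ((f \<circ> insert_index i) a) ((g \<circ> insert_index j) b))"
      by (rule eq_matI) (auto simp: mat_delete_def M_def insert_index_def)
    ultimately have del: "det (mat_delete M i j) \<in> {-1, 0, 1}"
      by simp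
    have "det M = (\<Sum>j'<Suc k. M $$ (i, j') * cofactor M i j')"
      by (rule laplace_expansion_row[OF M i])
    also have "\<dots> = (\<Sum>j'<Suc k. if j' = j then M $$ (i, j) * cofactor M i j else 0)"
      by (rule sum.cong) (use 0 in auto)
    also have "\<dots> = M $$ (i, j) * cofactor M i j"
      using j by simp
    finally have "det M = M $$ (i, j) * ((-1) ^ (i + j) * det (mat_delete M i j))"
      by (simp add: cofactor_def)
    moreover have "M $$ (i, j) \<in> {-1, 0, 1}"
      using i j by (auto simp: M_def incidence_def split: prod.split)
    moreover have "(-1::real) ^ (i + j) \<in> {-1, 1}"
      by (cases "even (i + j)") auto
    ultimately show ?thesis
      using del unfolding M_def[symmetric] by auto
  next
    case False
    define e where "e = vec (Suc k) (\<lambda>_. 1 :: real)"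
    have e: "e \<in> carrier_vec (Suc k)" "e \<noteq> 0\<^sub>v (Suc k)"
      by (auto simp: e_def vec_eq_iff)
    \<comment> \<open>Each row now has nonzero entries in two columns, which \<open>g\<close> sends
      to distinct nodes. These can only be the two endpoints, so their entries 1 and -1 cancel and
      the all-ones vector \<open>e\<close> lies in the kernel.\<close>
    have "(\<Sum>j<Suc k. incidence (f i) (g j)) = 0" if i: "i < Suc k" for i
    proof -
      obtain a b where ab: "f i = (a, b)"
        by (cases "f i")
      have two: "\<exists>j'<Suc k. j' \<noteq> j \<and> incidence (a, b) (g j') \<noteq> 0" if "j < Suc k" for j
        using False i that ab by (force simp: M_def)
      obtain p where p: "p < Suc k" "incidence (a, b) (g p) \<noteq> 0"
        using two[of 0] by auto
      obtain q where q: "q < Suc k" "q \<noteq> p" "incidence (a, b) (g q) \<noteq> 0"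
        using two[OF p(1)] by auto
      have "g p \<noteq> g q"
        using Suc.prems p q by (auto simp: inj_on_def)
      then have "{g p, g q} = {a, b}"
        using p(2) q(3) by (auto simp: incidence_def split: if_splits)
      then have "a \<in> g ` {..<Suc k}" "b \<in> g ` {..<Suc k}"
        using p(1) q(1) by (metis imageI insertCI insertE lessThan_iff singletonD)+
      moreover have "(\<Sum>j<Suc k. incidence (f i) (g j)) =
          (\<Sum>v\<in>g ` {..<Suc k}. incidence (a, b) v * 1)"
        by (simp only: sum.reindex[OF Suc.prems] ab o_def mult_1_right)
      ultimately show ?thesis
        by (simp only: sum_incidence finite_imageI finite_lessThan if_True diff_self)
    qed
    then have "M *\<^sub>v e = 0\<^sub>v (Suc k)"
      by (intro eq_vecI)
        (auto simp: M_def e_def scalar_prod_def row_def atLeast0LessThan simp del: sum.lessThan_Suc)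
    with e have "det M = 0"
      using det_0_iff_vec_prod_zero[OF M] by blast
    then show ?thesis
      by (simp add: M_def)
  qed
qed

lemma totally_unimodular_incidence: "totally_unimodular R C incidence"
  unfolding totally_unimodular_def by (intro allI impI, elim conjE) (rule det_incidence)

text \<open>With as many rows as variables the system is square. A nonzero kernel vector makes the
  determinant vanish, hence also that of the transpose, whose kernel vector is a linear dependence
  of the rows.\<close>

lemma lp_rows_independent_kernel:
  assumes "finite (lp_vars P)" and "finite I" and "card I = card (lp_vars P)"
    and indep: "lp_rows_independent P I"
    and h: "\<And>r. r \<in> I \<Longrightarrow> lp_lhs P h r = 0" and v: "v \<in> lp_vars P"
  shows "h v = 0"
proof (rule ccontr)
  assume nz: "h v \<noteq> 0"
  define n where "n = card (lp_vars P)"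
  obtain f where f: "bij_betw f {..<n} I"
    using ex_bij_betw_nat_finite[OF assms(2)] assms(3) by (auto simp: n_def atLeast0LessThan)
  obtain g where g: "bij_betw g {..<n} (lp_vars P)"
    using ex_bij_betw_nat_finite[OF assms(1)] by (auto simp: n_def atLeast0LessThan)
  define M where "M = mat n n (\<lambda>(i, j). lp_mat P (f i) (g j))"
  have M: "M \<in> carrier_mat n n"
    by (simp add: M_def)
  have "M *\<^sub>v vec n (h \<circ> g) = 0\<^sub>v n"
  proof (rule eq_vecI)
    fix i assume "i < dim_vec (0\<^sub>v n :: real vec)"
    then have i: "i < n"
      by simp
    then have "f i \<in> I"
      using f by (auto simp: bij_betw_def)
    from h[OF this] have "(\<Sum>j<n. lp_mat P (f i) (g j) * h (g j)) = 0"
      unfolding lp_lhs_def sum.reindex_bij_betw[OF g, symmetric] .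
    then show "(M *\<^sub>v vec n (h \<circ> g)) $ i = 0\<^sub>v n $ i"
      using i by (simp add: M_def scalar_prod_def row_def atLeast0LessThan)
  qed (simp add: M_def)
  moreover have "vec n (h \<circ> g) \<noteq> 0\<^sub>v n"
  proof -
    obtain j where "j < n" "g j = v"
      using v unfolding bij_betw_imp_surj_on[OF g, symmetric] by auto
    then have "vec n (h \<circ> g) $ j \<noteq> 0\<^sub>v n $ j"
      using nz by simp
    then show ?thesis
      by metis
  qed
  ultimately have "det M = 0"
    using det_0_iff_vec_prod_zero[OF M] vec_carrier by blast
  then have "det (transpose_mat M) = 0"
    by (simp add: det_transpose[OF M])
  then obtain u where u: "u \<in> carrier_vec n" "u \<noteq> 0\<^sub>v n" "transpose_mat M *\<^sub>v u = 0\<^sub>v n"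
    using det_0_iff_vec_prod_zero[of "transpose_mat M" n] M by auto
  \<comment> \<open>Carries the kernel vector of the transpose from positions back to the rows in
    \<open>I\<close>.\<close>
  define c where "c r = u $ the_inv_into {..<n} f r" for r
  have c: "c (f i) = u $ i" if "i < n" for i
    using that by (simp add: c_def the_inv_into_f_f[OF bij_betw_imp_inj_on[OF f]])
  have "(\<Sum>r\<in>I. c r * lp_mat P r j) = 0" if j: "j \<in> lp_vars P" for j
  proof -
    obtain l where l: "l < n" "g l = j"
      using j unfolding bij_betw_imp_surj_on[OF g, symmetric] by auto
    have "(\<Sum>r\<in>I. c r * lp_mat P r j) = (\<Sum>i<n. c (f i) * lp_mat P (f i) j)"
      by (rule sum.reindex_bij_betw[OF f, symmetric])
    also have "\<dots> = (\<Sum>i<n. M $$ (i, l) * u $ i)"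
      using l by (intro sum.cong) (auto simp: c M_def)
    also have "\<dots> = (transpose_mat M *\<^sub>v u) $ l"
      using l u(1) M by (simp add: scalar_prod_def atLeast0LessThan)
    finally show ?thesis
      using u(3) l by simp
  qed
  then have "\<forall>r\<in>I. c r = 0"
    using indep by (auto simp: lp_rows_independent_def)
  then have "u $ i = 0" if "i < n" for i
    using c[OF that] f that by (auto simp: bij_betw_def)
  then have "u = 0\<^sub>v n"
    using u(1) by (intro eq_vecI) auto
  with u(2) show False
    by blast
qed

section \<open>Systems of difference constraints\<close>

text \<open>Raising \<open>n\<close> by 1 moves the window of \<open>N\<close> consecutive
  numerators: the term \<open>n div N\<close> leaves and \<open>(n + N) div N\<close>, larger by 1,
  enters. At \<open>n = 0\<close> all terms vanish.\<close>

lemma sum_div_shift: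
  fixes n :: int
  assumes "0 < N"
  shows "(\<Sum>k<N. (n + int k) div int N) = n"
proof -
  have step: "(\<Sum>k<N. (n + 1 + int k) div int N) = (\<Sum>k<N. (n + int k) div int N) + 1" for n
  proof -
    obtain M where N: "N = Suc M"
      using assms by (cases N) auto
    have "(\<Sum>k<N. (n + 1 + int k) div int N) = (\<Sum>k<N. (n + int (Suc k)) div int N)"
      by (simp add: algebra_simps)
    also have "\<dots> = (\<Sum>k<Suc N. (n + int k) div int N) - n div int N"
      by (subst sum.lessThan_Suc_shift) simp
    also have "\<dots> = (\<Sum>k<N. (n + int k) div int N) + (n + int N) div int N - n div int N"
      by simp
    also have "(n + int N) div int N = n div int N + 1"
      using assms by simp
    finally show ?thesis
      by simp
  qed
  show ?thesis
  proof (induction n rule: int_induct[where k = 0])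
    case base
    show ?case
      by (simp add: div_pos_pos_trivial)
  next
    case (step1 i)
    then show ?case
      using step[of i] by simp
  next
    case (step2 i)
    then show ?case
      using step[of "i - 1"] by simp
  qed
qed

lemma hermite_identity:
  fixes x :: real and N :: nat
  assumes "0 < N"
  shows "(\<Sum>k<N. \<lfloor>x + real k / real N\<rfloor>) = \<lfloor>real N * x\<rfloor>"
proof -
  have "\<lfloor>x + real k / real N\<rfloor> = (\<lfloor>real N * x\<rfloor> + int k) div int N" for k :: nat
  proof -
    have "x + real k / real N = (real N * x + of_int (int k)) / of_int (int N)"
      using assms by (simp add: field_simps)
    also have "\<lfloor>\<dots>\<rfloor> = \<lfloor>real N * x + of_int (int k)\<rfloor> div int N"
      by (rule floor_divide_real_eq_div) simp
    finally show ?thesis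
      by simp
  qed
  then show ?thesis
    using sum_div_shift[OF assms] by simp
qed

section \<open>Integrality and optimality for difference constraints\<close>

locale difference_lp =
  fixes P :: "('n \<times> 'n, 'n) lp"
  assumes finite_vars: "finite (lp_vars P)"
    and mat: "lp_mat P = incidence"
    and rhs_Ints: "r \<in> lp_ineqs P \<union> lp_eqs P \<Longrightarrow> lp_rhs P r \<in> \<int>"
begin

text \<open>All names that are not variables play the role of a single node of potential \<open>0\<close>.\<close>

definition potential :: "('n \<Rightarrow> real) \<Rightarrow> 'n \<Rightarrow> real" where
  "potential y v = (if v \<in> lp_vars P then y v else 0)"

lemma lhs: "lp_lhs P y (a, b) = potential y a - potential y b"
  by (simp add: lp_lhs_def mat sum_incidence[OF finite_vars] potential_def)

lemma lhs_add: "lp_lhs P (\<lambda>v. y v + z v) r = lp_lhs P y r + lp_lhs P z r"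
  by (simp add: lp_lhs_def ring_distribs sum.distrib)

lemma lhs_diff: "lp_lhs P (\<lambda>v. y v - z v) r = lp_lhs P y r - lp_lhs P z r"
  by (simp add: lp_lhs_def ring_distribs sum_subtractf)

lemma objective_add: "lp_objective P (\<lambda>v. y v + z v) = lp_objective P y + lp_objective P z"
  by (simp add: lp_objective_def ring_distribs sum.distrib)

lemma objective_diff: "lp_objective P (\<lambda>v. y v - z v) = lp_objective P y - lp_objective P z"
  by (simp add: lp_objective_def ring_distribs sum_subtractf)

lemma integral_lhs: "lp_integral P y \<Longrightarrow> lp_lhs P y r \<in> \<int>"
  by (cases r) (auto simp: lhs lp_integral_def potential_def)

text \<open>
  Along an active row integrality of the potential propagates, so the indicator of the
  fractional variables lies in the kernel of the active rows.
\<close>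

lemma basic_integral:
  assumes "lp_basic P y"
  shows "lp_integral P y"
proof -
  obtain I where I: "I \<subseteq> lp_active P y" "finite I" "card I = card (lp_vars P)"
    "lp_rows_independent P I"
    using assms by (auto simp: lp_basic_def)
  define h where "h v = (of_bool (potential y v \<notin> \<int>) :: real)" for v
  \<comment> \<open>Outside the variables the potential is 0, an integer, so \<open>h\<close>
    already vanishes there.\<close>
  have ph: "potential h v = h v" for v
    by (simp add: potential_def h_def)
  have "lp_lhs P h r = 0" if "r \<in> I" for r
  proof -
    obtain a b where r: "r = (a, b)"
      by (cases r)
    have "potential y a - potential y b = lp_rhs P r" "r \<in> lp_ineqs P \<union> lp_eqs P"
      using I(1) that by (auto simp: lp_active_def lhs r)
    then have "potential y a - potential y b \<in> \<int>"
      using rhs_Ints by simp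
    then have "potential y a \<in> \<int> \<longleftrightarrow> potential y b \<in> \<int>"
      using Ints_diff[of "potential y a" "potential y a - potential y b"]
        Ints_add[of "potential y a - potential y b" "potential y b"] by auto
    then show ?thesis
      by (simp add: r lhs ph h_def)
  qed
  then have "h v = 0" if "v \<in> lp_vars P" for v
    by (rule lp_rows_independent_kernel[OF finite_vars I(2,3,4) _ that])
  then show ?thesis
    by (auto simp: lp_integral_def h_def potential_def)
qed

text \<open>The floor is monotone and commutes with adding an integer, so an integer bound on a
  difference survives rounding. The range of \<open>t\<close> ensures that the fixed potential 0
  rounds to 0.\<close>

lemma feasible_floor:
  assumes "lp_feasible P y" and "0 \<le> t" and "t < 1"
  shows "lp_feasible P (\<lambda>v. of_int \<lfloor>y v + t\<rfloor>)"
proof -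
  define z where "z v = (of_int \<lfloor>y v + t\<rfloor> :: real)" for v
  have pz: "potential z v = of_int \<lfloor>potential y v + t\<rfloor>" for v
    using assms(2,3) by (simp add: potential_def z_def floor_eq_iff)
  have le: "lp_lhs P z r \<le> of_int q" if le: "lp_lhs P y r \<le> of_int q" for r q
  proof -
    obtain a b where r: "r = (a, b)"
      by (cases r)
    have "potential y a + t \<le> (potential y b + t) + of_int q"
      using le by (simp add: r lhs)
    then have "\<lfloor>potential y a + t\<rfloor> \<le> \<lfloor>(potential y b + t) + of_int q\<rfloor>"
      by (rule floor_mono)
    then show ?thesis
      by (simp add: r lhs pz del: add.assoc)
  qed
  have eq: "lp_lhs P z r = of_int q" if eq: "lp_lhs P y r = of_int q" for r q
  proof -
    obtain a b where r: "r = (a, b)"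
      by (cases r)
    have "potential y a + t = (potential y b + t) + of_int q"
      using eq by (simp add: r lhs)
    then have "\<lfloor>potential y a + t\<rfloor> = \<lfloor>potential y b + t\<rfloor> + q"
      by (simp only: floor_add_int)
    then show ?thesis
      by (simp add: r lhs pz)
  qed
  have "lp_feasible P z"
    unfolding lp_feasible_def
  proof (intro conjI ballI)
    fix r
    assume r: "r \<in> lp_ineqs P"
    then obtain q where "lp_rhs P r = of_int q"
      using rhs_Ints[of r] by (auto elim: Ints_cases)
    then show "lp_lhs P z r \<le> lp_rhs P r"
      using le[of r q] assms(1) r by (auto simp: lp_feasible_def)
  next
    fix r
    assume r: "r \<in> lp_eqs P"
    then obtain q where "lp_rhs P r = of_int q"
      using rhs_Ints[of r] by (auto elim: Ints_cases)
    then show "lp_lhs P z r = lp_rhs P r"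
      using eq[of r q] assms(1) r by (auto simp: lp_feasible_def)
  qed
  then show ?thesis
    by (simp add: z_def[abs_def])
qed

text \<open>
  Rounding down with the \<open>N\<close> offsets \<open>k/N\<close> yields \<open>N\<close> feasible integral points whose mean is,
  by Hermite's identity, within \<open>1/N\<close> of the given point.
\<close>

lemma ip_optimal_imp_lp_optimal:
  assumes "ip_optimal P z"
  shows "lp_optimal P z"
  unfolding lp_optimal_def
proof (intro conjI allI impI)
  show "lp_feasible P z"
    using assms by (simp add: ip_optimal_def)
  fix y
  assume y: "lp_feasible P y"
  define C where "C = (\<Sum>v\<in>lp_vars P. \<bar>lp_cost P v\<bar>)"
  \<comment> \<open>The bound \<open>C\<close> does not depend on \<open>N\<close>, so by the
    Archimedean property a positive gap would be contradictory.\<close>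
  have bound: "real N * (lp_objective P z - lp_objective P y) \<le> C" if N: "0 < N" for N :: nat
  proof -
    have "lp_objective P z \<le> lp_objective P (\<lambda>v. of_int \<lfloor>y v + real k / real N\<rfloor>)" if "k < N" for k :: nat
      using assms feasible_floor[OF y, of "real k / real N"] that by (simp add: ip_optimal_def lp_integral_def)
    then have "(\<Sum>k<N. lp_objective P z) \<le> (\<Sum>k<N. lp_objective P (\<lambda>v. of_int \<lfloor>y v + real k / real N\<rfloor>))"
      by (intro sum_mono) auto
    also have "\<dots> = (\<Sum>v\<in>lp_vars P. \<Sum>k<N. lp_cost P v * of_int \<lfloor>y v + real k / real N\<rfloor>)"
      unfolding lp_objective_def by (rule sum.swap)
    also have "\<dots> = (\<Sum>v\<in>lp_vars P. lp_cost P v * of_int \<lfloor>real N * y v\<rfloor>)"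
      by (simp only: sum_distrib_left[symmetric] of_int_sum[symmetric] hermite_identity[OF N])
    also have "\<dots> \<le> (\<Sum>v\<in>lp_vars P. real N * (lp_cost P v * y v) + \<bar>lp_cost P v\<bar>)"
    proof (rule sum_mono)
      fix v
      have "lp_cost P v * (of_int \<lfloor>real N * y v\<rfloor> - real N * y v) \<le> \<bar>lp_cost P v\<bar> * 1"
      proof (rule order_trans[OF abs_ge_self])
        have "\<bar>of_int \<lfloor>real N * y v\<rfloor> - real N * y v\<bar> \<le> 1"
          by linarith
        then show "\<bar>lp_cost P v * (of_int \<lfloor>real N * y v\<rfloor> - real N * y v)\<bar> \<le> \<bar>lp_cost P v\<bar> * 1"
          unfolding abs_mult by (rule mult_left_mono) simp
      qed
      then show "lp_cost P v * of_int \<lfloor>real N * y v\<rfloor> \<le> real N * (lp_cost P v * y v) + \<bar>lp_cost P v\<bar>"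
        by (simp add: algebra_simps)
    qed
    also have "\<dots> = N * lp_objective P y + C"
      by (simp add: sum.distrib C_def lp_objective_def sum_distrib_left)
    finally show ?thesis
      by (simp add: algebra_simps)
  qed
  show "lp_objective P z \<le> lp_objective P y"
  proof (rule ccontr)
    assume "\<not> ?thesis"
    then have "0 < lp_objective P z - lp_objective P y"
      by simp
    then obtain N :: nat where N: "C < real N * (lp_objective P z - lp_objective P y)"
      using ex_less_of_nat_mult by blast
    moreover have "0 \<le> C"
      by (simp add: C_def sum_nonneg)
    ultimately have "0 < N"
      by (intro gr0I) auto
    then show False
      using bound[of N] N by simp
  qed
qed

text \<open>The active rows as edges of an undirected graph: along each edge the difference of the
  potentials is fixed.\<close>

definition active_rel :: "('n \<Rightarrow> real) \<Rightarrow> ('n \<times> 'n) set" where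
  "active_rel y = lp_active P y \<union> (lp_active P y)\<inverse>"

lemma sym_active_rel: "(a, b) \<in> active_rel y \<Longrightarrow> (b, a) \<in> active_rel y"
  by (auto simp: active_rel_def)

text \<open>A breadth-first spanning tree of the active rows gives the independent set.\<close>

lemma connected_basic:
  assumes feas: "lp_feasible P y"
    and conn: "lp_vars P \<subseteq> (active_rel y)\<^sup>* `` (- lp_vars P)"
  shows "lp_basic P y"
proof -
  let ?R = "active_rel y"
  define reach where "reach n v \<longleftrightarrow> (\<exists>u. u \<notin> lp_vars P \<and> (u, v) \<in> ?R ^^ n)" for n v
  define depth where "depth v = (LEAST n. reach n v)" for v
  have reach: "reach (depth v) v" if "v \<in> lp_vars P" for v
  proof -
    have "\<exists>n. reach n v"
      using conn that unfolding reach_def by (blast dest: rtrancl_imp_relpow)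
    then show ?thesis
      unfolding depth_def by (rule LeastI_ex)
  qed
  \<comment> \<open>The last edge of a shortest path from a non-variable to \<open>v\<close> starts
    either at a non-variable or at a variable closer to the non-variables.\<close>
  have parent: "\<exists>u. (u, v) \<in> ?R \<and> (u \<in> lp_vars P \<longrightarrow> depth u < depth v)" if v: "v \<in> lp_vars P" for v
  proof -
    obtain t where t: "t \<notin> lp_vars P" "(t, v) \<in> ?R ^^ depth v"
      using reach[OF v] by (auto simp: reach_def)
    show ?thesis
    proof (cases "depth v")
      case 0
      with t v show ?thesis
        by simp
    next
      case (Suc m)
      with t(2) obtain u where u: "(t, u) \<in> ?R ^^ m" "(u, v) \<in> ?R"
        by auto
      then have "depth u \<le> m"
        using t(1) unfolding depth_def by (intro Least_le) (auto simp: reach_def)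
      with u Suc show ?thesis
        by auto
    qed
  qed
  then obtain p where p: "\<And>v. v \<in> lp_vars P \<Longrightarrow> (p v, v) \<in> ?R"
    "\<And>v. v \<in> lp_vars P \<Longrightarrow> p v \<in> lp_vars P \<Longrightarrow> depth (p v) < depth v"
    by metis
  define row where "row v = (if (p v, v) \<in> lp_active P y then (p v, v) else (v, p v))" for v
  have row_active: "row v \<in> lp_active P y" if "v \<in> lp_vars P" for v
    using p(1)[OF that] by (auto simp: row_def active_rel_def)
  \<comment> \<open>Two variables sharing a row would be parents of each other, which the strict
    decrease of \<open>depth\<close> forbids.\<close>
  have inj: "inj_on row (lp_vars P)"
  proof (rule inj_onI, rule ccontr)
    fix v v'
    assume v: "v \<in> lp_vars P" "v' \<in> lp_vars P" and "row v = row v'" "v \<noteq> v'"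
    then have "p v = v'" "p v' = v"
      by (auto simp: row_def split: if_splits)
    then show False
      using p(2)[OF v(1)] p(2)[OF v(2)] v by simp
  qed
  have p_neq: "p v \<noteq> v" if "v \<in> lp_vars P" for v
    using p(2)[OF that] that by auto
  have "lp_rows_independent P (row ` lp_vars P)"
    unfolding lp_rows_independent_def
  proof (intro allI impI ballI, rule ccontr)
    fix u r
    assume zero: "\<forall>j\<in>lp_vars P. (\<Sum>r\<in>row ` lp_vars P. u r * lp_mat P r j) = 0"
      and r: "r \<in> row ` lp_vars P" "u r \<noteq> 0"
    \<comment> \<open>In a dependence take the deepest \<open>v\<close> whose row has a nonzero
      coefficient. Rows of children of \<open>v\<close> have coefficient 0, so column
      \<open>v\<close> keeps only the entry of \<open>row v\<close>, which is nonzero.\<close>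
    define S where "S = {v \<in> lp_vars P. u (row v) \<noteq> 0}"
    have "finite S" "S \<noteq> {}"
      using r finite_vars by (auto simp: S_def)
    then have "Max (depth ` S) \<in> depth ` S"
      by (intro Max_in) auto
    then obtain v where v: "v \<in> S" and "depth v = Max (depth ` S)"
      by auto
    then have max: "depth v' \<le> depth v" if "v' \<in> S" for v'
      using that \<open>finite S\<close> by simp
    have vP: "v \<in> lp_vars P"
      using v by (simp add: S_def)
    have off: "u (row v') * lp_mat P (row v') v = 0" if v': "v' \<in> lp_vars P" "v' \<noteq> v" for v'
    proof (cases "p v' = v \<and> v' \<in> S")
      case True
      then show ?thesis
        using p(2)[OF v'(1)] max[of v'] vP by auto
    next
      case False
      then show ?thesis
        using v' by (auto simp: S_def mat incidence_def row_def)
    qed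
    have "0 = (\<Sum>v'\<in>lp_vars P. u (row v') * lp_mat P (row v') v)"
      using zero vP sum.reindex[OF inj, of "\<lambda>r. u r * lp_mat P r v"] by (auto simp: o_def)
    also have "\<dots> = (\<Sum>v'\<in>lp_vars P. if v' = v then u (row v) * lp_mat P (row v) v else 0)"
      by (rule sum.cong) (use off in auto)
    also have "\<dots> = u (row v) * lp_mat P (row v) v"
      using vP finite_vars by simp
    finally have "lp_mat P (row v) v = 0"
      using v by (simp add: S_def)
    then show False
      using p_neq[OF vP] by (auto simp: mat incidence_def row_def split: if_splits)
  qed
  moreover have "row ` lp_vars P \<subseteq> lp_active P y"
    using row_active by blast
  ultimately show ?thesis
    using feas finite_vars card_image[OF inj] unfolding lp_basic_def by blast
qed

text \<open>
  The variables not joined to a fixed potential by active rows can be shifted together by \<open>1\<close> in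
  both directions.
\<close>

lemma optimal_shift:
  assumes opt: "lp_optimal P y" and int: "lp_integral P y"
  defines "T \<equiv> - ((active_rel y)\<^sup>* `` (- lp_vars P))"
  shows "lp_optimal P (\<lambda>v. y v + of_bool (v \<in> T))"
proof -
  define h where "h v = (of_bool (v \<in> T) :: real)" for v
  have feas: "lp_feasible P y"
    using opt by (simp add: lp_optimal_def)
  have "T \<subseteq> lp_vars P"
    by (auto simp: T_def)
  then have ph: "potential h v = h v" for v
    by (auto simp: potential_def h_def)
  have closed: "a \<in> T \<longleftrightarrow> b \<in> T" if "(a, b) \<in> active_rel y" for a b
  proof -
    have "c \<notin> T \<Longrightarrow> (c, d) \<in> active_rel y \<Longrightarrow> d \<notin> T" for c d
      by (auto simp: T_def intro: rtrancl_into_rtrancl)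
    then show ?thesis
      using that sym_active_rel[OF that] by blast
  qed
  have active: "lp_lhs P h r = 0" if "r \<in> lp_active P y" for r
    using closed[of "fst r" "snd r"] that
    by (cases r) (auto simp: lhs ph h_def active_rel_def)
  \<comment> \<open>Both sides are integers, so an inactive inequality has slack at least 1, enough
    for a change of at most 1 by \<open>h\<close>.\<close>
  have slack: "lp_lhs P y r + 1 \<le> lp_rhs P r" if "r \<in> lp_ineqs P" "r \<notin> lp_active P y" for r
  proof -
    have "lp_lhs P y r < lp_rhs P r"
      using that feas by (force simp: lp_active_def lp_feasible_def)
    moreover have "lp_lhs P y r \<in> \<int>" "lp_rhs P r \<in> \<int>"
      using integral_lhs[OF int] rhs_Ints that by auto
    ultimately show ?thesis
      by (auto elim!: Ints_cases)
  qed
  have h1: "\<bar>lp_lhs P h r\<bar> \<le> 1" for r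
    by (cases r) (auto simp: lhs ph h_def)
  have eqs: "r \<in> lp_active P y" if "r \<in> lp_eqs P" for r
    using feas that by (auto simp: lp_active_def lp_feasible_def)
  have ineq: "lp_lhs P y r + \<bar>lp_lhs P h r\<bar> \<le> lp_rhs P r" if "r \<in> lp_ineqs P" for r
    using slack[OF that] active[of r] h1[of r] feas that
    by (cases "r \<in> lp_active P y") (auto simp: lp_feasible_def)
  have "lp_lhs P y r + lp_lhs P h r \<le> lp_rhs P r" "lp_lhs P y r - lp_lhs P h r \<le> lp_rhs P r"
    if "r \<in> lp_ineqs P" for r
    using ineq[OF that] by linarith+
  moreover have "lp_lhs P y r = lp_rhs P r" "lp_lhs P h r = 0" if "r \<in> lp_eqs P" for r
    using active[OF eqs[OF that]] feas that by (auto simp: lp_feasible_def)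
  ultimately have "lp_feasible P (\<lambda>v. y v + h v)" "lp_feasible P (\<lambda>v. y v - h v)"
    by (simp_all add: lp_feasible_def lhs_add lhs_diff)
  \<comment> \<open>As \<open>y\<close> is optimal, moving along \<open>h\<close> in either
    direction cannot lower the objective, so \<open>h\<close> has objective 0.\<close>
  moreover from this have "lp_objective P y \<le> lp_objective P y + lp_objective P h"
    "lp_objective P y \<le> lp_objective P y - lp_objective P h"
    using opt unfolding lp_optimal_def objective_add[symmetric] objective_diff[symmetric] by blast+
  then have "lp_objective P h = 0"
    by simp
  ultimately have "lp_optimal P (\<lambda>v. y v + h v)"
    using opt by (simp add: lp_optimal_def objective_add)
  then show ?thesis
    by (simp add: h_def)
qed

text \<open>
  The optimal integral points are finitely many; the one with the largest coordinate sum admits no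
  further shift and is therefore basic.
\<close>

lemma ex_basic_optimal:
  assumes feas: "lp_feasible P y0" and int: "lp_integral P y0"
    and bounded: "\<And>y v. lp_feasible P y \<Longrightarrow> lp_objective P y \<le> lp_objective P y0 \<Longrightarrow>
      v \<in> lp_vars P \<Longrightarrow> \<bar>y v\<bar> \<le> B"
  shows "\<exists>y. lp_basic P y \<and> lp_optimal P y"
proof -
  \<comment> \<open>Fixing the value 0 off the variables makes this integral part of the sublevel
    set of \<open>y0\<close> finite; \<open>restrict\<close> shows that every point has such a
    representative.\<close>
  define Z where "Z = {y. lp_feasible P y \<and> lp_integral P y \<and> lp_objective P y \<le> lp_objective P y0 \<and>
    (\<forall>v. v \<notin> lp_vars P \<longrightarrow> y v = 0)}"
  have restrict: "\<exists>z. (\<forall>v. v \<notin> lp_vars P \<longrightarrow> z v = 0) \<and> (lp_feasible P z \<longleftrightarrow> lp_feasible P y) \<and>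
      (lp_integral P z \<longleftrightarrow> lp_integral P y) \<and> lp_objective P z = lp_objective P y" for y
  proof (intro exI conjI)
    have "lp_lhs P (potential y) r = lp_lhs P y r" for r
      by (simp add: lp_lhs_def potential_def)
    then show "lp_feasible P (potential y) \<longleftrightarrow> lp_feasible P y"
      by (simp add: lp_feasible_def)
  qed (auto simp: lp_integral_def lp_objective_def potential_def)
  define A where "A = (of_int ` {-\<lceil>B\<rceil>..\<lceil>B\<rceil>} :: real set)"
  have "Z \<subseteq> {y. \<forall>v. (v \<in> lp_vars P \<longrightarrow> y v \<in> A) \<and> (v \<notin> lp_vars P \<longrightarrow> y v = 0)}"
  proof (intro subsetI CollectI allI conjI impI)
    fix y v
    assume y: "y \<in> Z"
    show "y v \<in> A" if v: "v \<in> lp_vars P"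
    proof -
      obtain k where k: "y v = of_int k"
        using y v by (auto simp: Z_def lp_integral_def elim!: Ints_cases)
      have "\<bar>y v\<bar> \<le> B"
        using bounded[of y v] y v by (simp add: Z_def)
      then have "k \<in> {-\<lceil>B\<rceil>..\<lceil>B\<rceil>}"
        unfolding k atLeastAtMost_iff by linarith
      then show ?thesis
        by (auto simp: A_def k)
    qed
    show "v \<notin> lp_vars P \<Longrightarrow> y v = 0"
      using y by (simp add: Z_def)
  qed
  moreover have "finite {y. \<forall>v. (v \<in> lp_vars P \<longrightarrow> y v \<in> A) \<and> (v \<notin> lp_vars P \<longrightarrow> y v = 0)}"
    using finite_vars by (intro finite_set_of_finite_funs) (auto simp: A_def)
  ultimately have finZ: "finite Z"
    by (rule finite_subset)
  have "\<exists>z0. z0 \<in> Z"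
    using restrict[of y0] feas int by (auto simp: Z_def)
  then obtain z0 where "z0 \<in> Z" ..
  have in_Z: "y \<in> Z" if "lp_optimal P y" "lp_integral P y" "\<forall>v. v \<notin> lp_vars P \<longrightarrow> y v = 0" for y
    using that feas by (auto simp: Z_def lp_optimal_def)
  define m where "m = Min (lp_objective P ` Z)"
  have "m \<in> lp_objective P ` Z"
    using finZ \<open>z0 \<in> Z\<close> unfolding m_def by (intro Min_in) auto
  then obtain z1 where z1: "z1 \<in> Z" "lp_objective P z1 = m"
    by auto
  have "ip_optimal P z1"
    unfolding ip_optimal_def
  proof (intro conjI allI impI)
    fix y
    assume y: "lp_feasible P y \<and> lp_integral P y"
    obtain z where z: "\<forall>v. v \<notin> lp_vars P \<longrightarrow> z v = 0" "lp_feasible P z" "lp_integral P z"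
      "lp_objective P z = lp_objective P y"
      using restrict[of y] y by auto
    show "lp_objective P z1 \<le> lp_objective P y"
    proof (cases "lp_objective P y \<le> lp_objective P y0")
      case True
      with z have "z \<in> Z"
        by (simp add: Z_def)
      then have "m \<le> lp_objective P z"
        using finZ by (simp add: m_def)
      with z z1 show ?thesis
        by simp
    next
      case False
      with z1 show ?thesis
        by (simp add: Z_def)
    qed
  qed (use z1 in \<open>auto simp: Z_def\<close>)
  then have "lp_optimal P z1"
    by (rule ip_optimal_imp_lp_optimal)
  define Opt where "Opt = {y \<in> Z. lp_optimal P y}"
  define total where "total y = (\<Sum>v\<in>lp_vars P. y v)" for y :: "'n \<Rightarrow> real"
  have finOpt: "finite Opt" and "z1 \<in> Opt"
    using finZ z1 \<open>lp_optimal P z1\<close> by (auto simp: Opt_def)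
  then have "Max (total ` Opt) \<in> total ` Opt"
    by (intro Max_in) auto
  then obtain y where y: "y \<in> Opt" "total y = Max (total ` Opt)"
    by auto
  define T where "T = - ((active_rel y)\<^sup>* `` (- lp_vars P))"
  have T: "T \<subseteq> lp_vars P"
    by (auto simp: T_def)
  define y' where "y' v = y v + of_bool (v \<in> T)" for v
  have "lp_optimal P y'"
    using optimal_shift[of y] y(1) by (simp add: Opt_def Z_def y'_def[abs_def] T_def)
  moreover have "lp_integral P y'"
    using y(1) by (auto simp: Opt_def Z_def lp_integral_def y'_def)
  moreover have "\<forall>v. v \<notin> lp_vars P \<longrightarrow> y' v = 0"
    using y(1) T by (auto simp: Opt_def Z_def y'_def)
  ultimately have "y' \<in> Opt"
    using in_Z by (simp add: Opt_def)
  then have "total y' \<le> total y"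
    using finOpt y(2) by simp
  moreover have "total y' = total y + card T"
    using T finite_vars by (simp add: total_def y'_def sum.distrib Int_absorb1)
  ultimately have "T = {}"
    using finite_subset[OF T finite_vars] by simp
  then have "lp_vars P \<subseteq> (active_rel y)\<^sup>* `` (- lp_vars P)"
    by (auto simp: T_def)
  then have "lp_basic P y"
    using y(1) by (intro connected_basic) (auto simp: Opt_def Z_def)
  then show ?thesis
    using y(1) by (auto simp: Opt_def)
qed

end

section \<open>The stage program and its network\<close>

text \<open>Turns a column sum of the constraint matrix, which runs over all edges, into the
  neighbourhood sum appearing in the equation at a node.\<close>

lemma sum_edges_tail:
  assumes "finite E"
  shows "(\<Sum>(i, j)\<in>E. of_bool (i = k) * f i j) = (\<Sum>j | (k, j) \<in> E. f k j :: real)"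
proof -
  have "(\<Sum>(i, j)\<in>E. of_bool (i = k) * f i j) = (\<Sum>r\<in>E. if fst r = k then f (fst r) (snd r) else 0)"
    by (rule sum.cong) auto
  also have "\<dots> = (\<Sum>r | r \<in> E \<and> fst r = k. f (fst r) (snd r))"
    using assms by (simp add: sum.If_cases Int_def)
  also have "\<dots> = (\<Sum>j | (k, j) \<in> E. f k j)"
    by (rule sum.reindex_bij_witness[of _ "\<lambda>j. (k, j)" snd]) auto
  finally show ?thesis .
qed

lemma sum_edges_head:
  assumes "finite E"
  shows "(\<Sum>(i, j)\<in>E. of_bool (j = k) * f i j) = (\<Sum>i | (i, k) \<in> E. f i k :: real)"
proof -
  have "(\<Sum>(i, j)\<in>E. of_bool (j = k) * f i j) = (\<Sum>r\<in>E. if snd r = k then f (fst r) (snd r) else 0)"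
    by (rule sum.cong) auto
  also have "\<dots> = (\<Sum>r | r \<in> E \<and> snd r = k. f (fst r) (snd r))"
    using assms by (simp add: sum.If_cases Int_def)
  also have "\<dots> = (\<Sum>i | (i, k) \<in> E. f i k)"
    by (rule sum.reindex_bij_witness[of _ "\<lambda>i. (i, k)" fst]) auto
  finally show ?thesis .
qed

lemma sum_vertex:
  assumes "finite V"
  shows "(\<Sum>i\<in>V. of_bool (i = k) * f i) = (of_bool (k \<in> V) * f k :: real)"
proof -
  have "(\<Sum>i\<in>V. of_bool (i = k) * f i) = (\<Sum>i\<in>V. if i = k then f i else 0)"
    by (rule sum.cong) auto
  then show ?thesis
    using assms by simp
qed

lemma source_subset: "source V E \<subseteq> V" and sink_subset: "sink V E \<subseteq> V"
  by (auto simp: source_def sink_def)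

locale stage =
  fixes V :: "'v set" and E ES :: "('v \<times> 'v) set" and w :: "'v \<Rightarrow> real" and WK :: real
  assumes finV: "finite V" and V_ne: "V \<noteq> {}" and E_sub: "E \<subseteq> V \<times> V" and acyc: "acyclic E"
    and ES_sub: "ES \<subseteq> E" and w_pos: "\<And>i. i \<in> V \<Longrightarrow> 0 < w i" and WK_pos: "0 < WK"
begin

abbreviation "P \<equiv> stage_lp V E ES w WK"
abbreviation "G \<equiv> stage_network V E"

lemma finE: "finite E"
  using finite_subset[OF E_sub] finV by simp

lemma fin_source: "finite (source V E)" and fin_sink: "finite (sink V E)"
  using finV source_subset sink_subset by (metis finite_subset)+

lemma stage_eqs_image:
  "stage_eqs V E = (\<lambda>i. (NC i, N0)) ` source V E \<union> (\<lambda>i. (ND i, NK)) ` sink V E"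
  by (auto simp: stage_eqs_def)

lemma stage_ineqs_image:
  "stage_ineqs V E =
    (\<lambda>i. (NC i, ND i)) ` V \<union> ((\<lambda>i. (NC i, NE i)) ` V \<union> ((\<lambda>i. (NE i, NC i)) ` V \<union>
    ((\<lambda>(i, j). (NC i, NC j)) ` E \<union> ((\<lambda>(i, j). (NC j, ND i)) ` E \<union> (\<lambda>(i, j). (NE i, NE j)) ` E))))"
  unfolding stage_ineqs_def by force

lemma fin_eqs: "finite (stage_eqs V E)" and fin_ineqs: "finite (stage_ineqs V E)"
  by (simp_all add: stage_eqs_image stage_ineqs_image finV finE fin_source fin_sink)

lemma eqs_ineqs_disjoint: "stage_eqs V E \<inter> stage_ineqs V E = {}"
  by (auto simp: stage_eqs_def stage_ineqs_def)

lemma sum_stage_eqs: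
  "(\<Sum>r\<in>stage_eqs V E. f r) = (\<Sum>i\<in>source V E. f (NC i, N0)) + (\<Sum>i\<in>sink V E. f (ND i, NK) :: real)"
  unfolding stage_eqs_image
  by (subst sum.union_disjoint) (auto simp: fin_source fin_sink sum.reindex inj_on_def)

lemma sum_stage_ineqs:
  fixes f :: "'v node \<times> 'v node \<Rightarrow> real"
  shows "(\<Sum>r\<in>stage_ineqs V E. f r) =
    (\<Sum>i\<in>V. f (NC i, ND i) + f (NC i, NE i) + f (NE i, NC i)) +
    (\<Sum>(i, j)\<in>E. f (NC i, NC j) + f (NC j, ND i) + f (NE i, NE j))"
proof -
  \<comment> \<open>A loop would identify an index of \<open>c_i - d_i\<close> with one of
    \<open>c_j - d_i\<close>, and the six families would not be disjoint.\<close>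
  have irr: "(i, i) \<notin> E" for i
    using acyc by (auto simp: acyclic_def)
  have "(\<Sum>r\<in>stage_ineqs V E. f r) =
      (\<Sum>r\<in>(\<lambda>i. (NC i, ND i)) ` V. f r) + ((\<Sum>r\<in>(\<lambda>i. (NC i, NE i)) ` V. f r) +
      ((\<Sum>r\<in>(\<lambda>i. (NE i, NC i)) ` V. f r) + ((\<Sum>r\<in>(\<lambda>(i, j). (NC i, NC j)) ` E. f r) +
      ((\<Sum>r\<in>(\<lambda>(i, j). (NC j, ND i)) ` E. f r) + (\<Sum>r\<in>(\<lambda>(i, j). (NE i, NE j)) ` E. f r)))))"
    unfolding stage_ineqs_image
    by (subst sum.union_disjoint; (auto simp: finV finE irr; fail)?)+
  also have "\<dots> = (\<Sum>i\<in>V. f (NC i, ND i)) + ((\<Sum>i\<in>V. f (NC i, NE i)) + ((\<Sum>i\<in>V. f (NE i, NC i)) +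
      ((\<Sum>(i, j)\<in>E. f (NC i, NC j)) + ((\<Sum>(i, j)\<in>E. f (NC j, ND i)) + (\<Sum>(i, j)\<in>E. f (NE i, NE j))))))"
    by (simp add: sum.reindex inj_on_def case_prod_unfold prod_eq_iff o_def)
  finally show ?thesis
    by (simp add: sum.distrib case_prod_unfold)
qed

section \<open>Balances at the nodes\<close>

text \<open>The transposed constraint matrix applied to \<open>x\<close>, extended to a row for
  \<open>N0\<close>: outflow minus inflow at \<open>n\<close>. Both the dual equations and the flow
  balances are compared with it.\<close>

definition net :: "('v node \<times> 'v node \<Rightarrow> real) \<Rightarrow> 'v node \<Rightarrow> real" where
  "net x n = (\<Sum>r\<in>stage_ineqs V E. incidence r n * x r) + (\<Sum>r\<in>stage_eqs V E. incidence r n * x r)"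

lemmas edge_sums = sum_edges_tail[OF finE] sum_edges_head[OF finE]

lemma net_N0: "net x N0 = - stage_eq_lhs V E x N0"
  by (simp add: net_def sum_stage_ineqs sum_stage_eqs incidence_def sum_negf)

lemma net_NK: "net x NK = - stage_eq_lhs V E x NK"
  by (simp add: net_def sum_stage_ineqs sum_stage_eqs incidence_def sum_negf)

lemma net_NC:
  assumes "k \<in> V"
  shows "net x (NC k) = stage_eq_lhs V E x (NC k)"
proof -
  \<comment> \<open>An edge meets \<open>c_k\<close> through its tail in \<open>c_i - c_j\<close>,
    and through its head in \<open>c_i - c_j\<close> and \<open>c_j - d_i\<close>; the sums are
    grouped accordingly.\<close>
  have "net x (NC k) =
      (\<Sum>i\<in>V. of_bool (i = k) * (x (NC i, ND i) + x (NC i, NE i) - x (NE i, NC i))) +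
      ((\<Sum>(i, j)\<in>E. of_bool (i = k) * x (NC i, NC j)) +
       (\<Sum>(i, j)\<in>E. of_bool (j = k) * (x (NC j, ND i) - x (NC i, NC j)))) +
      (\<Sum>i\<in>source V E. of_bool (i = k) * x (NC i, N0))"
    unfolding net_def sum_stage_ineqs sum_stage_eqs sum.distrib[symmetric]
    by (intro arg_cong2[where f = "(+)"] sum.cong)
      (auto simp: incidence_def algebra_simps eq_commute[of k])
  then show ?thesis
    using assms by (simp add: edge_sums sum_vertex finV fin_source)
qed

lemma net_ND:
  assumes "k \<in> V"
  shows "net x (ND k) = stage_eq_lhs V E x (ND k)"
proof -
  have "net x (ND k) =
      (\<Sum>i\<in>V. of_bool (i = k) * (- x (NC i, ND i))) +
      (\<Sum>(i, j)\<in>E. of_bool (i = k) * (- x (NC j, ND i))) +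
      (\<Sum>i\<in>sink V E. of_bool (i = k) * x (ND i, NK))"
    unfolding net_def sum_stage_ineqs sum_stage_eqs
    by (simp add: incidence_def eq_commute[of k])
  then show ?thesis
    using assms by (simp only: edge_sums sum_vertex finV fin_sink) (simp add: sum_negf)
qed

lemma net_NE:
  assumes "k \<in> V"
  shows "net x (NE k) = stage_eq_lhs V E x (NE k)"
proof -
  have "net x (NE k) =
      (\<Sum>i\<in>V. of_bool (i = k) * (x (NE i, NC i) - x (NC i, NE i))) +
      ((\<Sum>(i, j)\<in>E. of_bool (i = k) * x (NE i, NE j)) +
       (\<Sum>(i, j)\<in>E. of_bool (j = k) * (- x (NE i, NE j))))"
    unfolding net_def sum_stage_ineqs sum_stage_eqs sum.distrib[symmetric]
    by (simp add: incidence_def) (intro arg_cong2[where f = "(+)"] sum.cong; auto simp: algebra_simps)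
  then show ?thesis
    using assms by (simp only: edge_sums sum_vertex finV) (simp add: sum_negf)
qed

text \<open>At \<open>N0\<close> and \<open>NK\<close> all arcs enter, so both sides change sign; at
  the other nodes the two equations coincide.\<close>

lemma net_eq_iff:
  assumes "n \<in> verts G"
  shows "stage_eq_lhs V E x n = stage_eq_rhs w WK n \<longleftrightarrow> net x n = stage_supply w WK n"
  using assms
  by (cases n) (auto simp: stage_network_def net_N0 net_NK net_NC net_ND net_NE
    simp del: stage_eq_lhs.simps)

lemma verts_eq: "verts G = insert N0 (stage_vars V)"
  by (auto simp: stage_network_def stage_vars_def)

lemma sum_arcs: "(\<Sum>r\<in>arcs G. f r) = (\<Sum>r\<in>stage_ineqs V E. f r) + (\<Sum>r\<in>stage_eqs V E. f r :: real)"
  by (simp add: stage_network_def sum.union_disjoint fin_eqs fin_ineqs eqs_ineqs_disjoint)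

lemma fin_arcs: "finite (arcs G)"
  by (simp add: stage_network_def fin_eqs fin_ineqs)

text \<open>The entry of an arc is 1 at its tail and -1 at its head, which splits \<open>net\<close>
  into outflow and inflow.\<close>

lemma flow_balance_iff: "flow_balance G s x n \<longleftrightarrow> net x n = s n"
proof -
  have *: "(\<Sum>r\<in>{r \<in> arcs G. q r = n}. x r) = (\<Sum>r\<in>arcs G. of_bool (n = q r) * x r)"
    for q :: "'v node \<times> 'v node \<Rightarrow> 'v node"
    by (subst sum.inter_filter[OF fin_arcs]) (auto intro: sum.cong)
  have "net x n = (\<Sum>r\<in>arcs G. incidence r n * x r)"
    by (simp add: net_def sum_arcs)
  also have "\<dots> = (\<Sum>r\<in>arcs G. of_bool (n = fst r) * x r - of_bool (n = snd r) * x r)"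
    by (simp add: incidence_def case_prod_unfold left_diff_distrib)
  also have "\<dots> = (\<Sum>r\<in>out_arcs G n. x r) - (\<Sum>r\<in>in_arcs G n. x r)"
    by (simp add: sum_subtractf *[symmetric] out_arcs_def in_arcs_def) (simp add: stage_network_def)
  finally show ?thesis
    by (simp add: flow_balance_def)
qed

lemma fin_digraph_network: "fin_digraph G"
proof
  show "finite (verts G)"
    by (simp add: verts_eq finV)
  show "finite (arcs G)"
    by (rule fin_arcs)
  fix a
  assume "a \<in> arcs G"
  then show "tail G a \<in> verts G" "head G a \<in> verts G"
    using E_sub source_subset[of V E] sink_subset[of V E]
    by (auto simp: stage_network_def stage_eqs_def stage_ineqs_def)
qed

section \<open>The dual program as a flow problem\<close>

lemma dual_nonneg_iff: "stage_dual_nonneg V E x \<longleftrightarrow> (\<forall>r\<in>stage_ineqs V E. 0 \<le> x r)"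
  unfolding stage_dual_nonneg_def stage_ineqs_def by blast

lemma dual_feasible_iff:
  "stage_dual_feasible V E w WK x \<longleftrightarrow>
    (\<forall>r\<in>stage_ineqs V E. 0 \<le> x r) \<and> (\<forall>n\<in>stage_vars V. net x n = stage_supply w WK n)"
proof -
  have "(\<forall>n\<in>stage_vars V. net x n = stage_supply w WK n) \<longleftrightarrow>
      (\<forall>n\<in>stage_vars V. stage_eq_lhs V E x n = stage_eq_rhs w WK n)"
    using net_eq_iff by (auto simp: verts_eq)
  then show ?thesis
    unfolding stage_dual_feasible_def dual_nonneg_iff
    by (auto simp: stage_vars_def simp del: stage_eq_lhs.simps stage_eq_rhs.simps)
qed

lemma lp_dual_feasible_iff: "lp_dual_feasible P x \<longleftrightarrow> stage_dual_feasible V E w WK x"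
proof -
  \<comment> \<open>On the variables the supplies are the negated costs, the right-hand side of the
    dual in the stated convention.\<close>
  have "- stage_cost w WK n = stage_supply w WK n" if "n \<in> stage_vars V" for n
    using that by (cases n) (auto simp: stage_vars_def)
  then show ?thesis
    by (simp add: lp_dual_feasible_def dual_feasible_iff net_def incidence_def[symmetric])
qed

lemma dual_objective: "lp_dual_objective P x = stage_dual_objective V E ES x"
proof -
  \<comment> \<open>The right-hand side of an \<open>e_i - e_j\<close> row is nonzero only on swept
    edges, so the sum over \<open>E\<close> collapses to \<open>ES\<close>.\<close>
  have "(\<Sum>(i, j)\<in>E. of_bool ((i, j) \<in> ES) * x (NE i, NE j)) = (\<Sum>(i, j)\<in>ES. x (NE i, NE j))"
  proof -
    have "(\<Sum>(i, j)\<in>E. of_bool ((i, j) \<in> ES) * x (NE i, NE j)) =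
        (\<Sum>r\<in>E. if r \<in> ES then x (NE (fst r), NE (snd r)) else 0)"
      by (rule sum.cong) auto
    also have "\<dots> = (\<Sum>r\<in>ES. x (NE (fst r), NE (snd r)))"
      using ES_sub finE by (simp add: sum.If_cases Int_absorb1)
    finally show ?thesis
      by (simp add: case_prod_unfold)
  qed
  then show ?thesis
    by (simp add: lp_dual_objective_def stage_dual_objective_def sum_stage_ineqs sum_stage_eqs
      sum_negf case_prod_unfold)
qed

lemma dual_objective_flow_cost: "stage_dual_objective V E ES x = flow_cost G (stage_rhs ES) x"
  by (simp add: dual_objective[symmetric] lp_dual_objective_def flow_cost_def sum_arcs)

text \<open>The free arcs are the equality rows, so nonnegativity is asked exactly on the inequality
  rows; the added equation is the balance at \<open>N0\<close>.\<close>

lemma flow_feasible_iff: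
  "stage_dual_feasible V E w WK x \<and> stage_eq_lhs V E x N0 = stage_eq_rhs w WK N0 \<longleftrightarrow>
    flow_feasible G (stage_supply w WK) (stage_eqs V E) x"
proof -
  have "arcs G - stage_eqs V E = stage_ineqs V E"
    using eqs_ineqs_disjoint by (auto simp: stage_network_def)
  moreover have "N0 \<in> verts G"
    by (simp add: verts_eq)
  ultimately show ?thesis
    unfolding flow_feasible_def flow_balance_iff dual_feasible_iff
    using net_eq_iff[of N0 x] by (auto simp: verts_eq simp del: stage_eq_lhs.simps)
qed

text \<open>Every arc leaves one node and enters another, so the balances of all nodes add up to \<open>0\<close>.\<close>

lemma sum_net: "(\<Sum>n\<in>verts G. net x n) = 0"
proof -
  interpret fin_digraph G
    by (rule fin_digraph_network)
  have "(\<Sum>n\<in>verts G. net x n) = (\<Sum>n\<in>verts G. \<Sum>r\<in>arcs G. incidence r n * x r)"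
    by (simp add: net_def sum_arcs)
  also have "\<dots> = (\<Sum>r\<in>arcs G. \<Sum>n\<in>verts G. incidence r n * x r)"
    by (rule sum.swap)
  also have "\<dots> = (\<Sum>r\<in>arcs G. 0)"
  proof (rule sum.cong)
    fix r
    assume "r \<in> arcs G"
    then have "fst r \<in> verts G" "snd r \<in> verts G"
      using tail_in_verts[of r] head_in_verts[of r] by (simp_all add: stage_network_def)
    then show "(\<Sum>n\<in>verts G. incidence r n * x r) = 0"
      using sum_incidence[OF finite_verts, of "fst r" "snd r" "\<lambda>_. x r"] by simp
  qed simp
  finally show ?thesis
    by simp
qed

lemma N0_combination:
  "\<exists>\<alpha>. \<forall>x. stage_eq_lhs V E x N0 - stage_eq_rhs w WK N0 =
    (\<Sum>n\<in>verts G - {N0}. \<alpha> n * (stage_eq_lhs V E x n - stage_eq_rhs w WK n))"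
proof (intro exI allI)
  fix x
  \<comment> \<open>Balances and supplies each total 0, so the balance equation at \<open>N0\<close>
    is minus the sum of the others. Its own sign reversal makes the coefficients 1, except at
    \<open>NK\<close>, which is reversed as well.\<close>
  let ?\<alpha> = "\<lambda>n. if n = NK then -1 else 1 :: real"
  have N0_notin: "N0 \<notin> stage_vars V"
    by (auto simp: stage_vars_def)
  have total_supply: "(\<Sum>n\<in>verts G. stage_supply w WK n) = 0"
  proof -
    \<comment> \<open>At the all-ones point the weight terms of the objective cancel, leaving
      \<open>WK\<close>; the supply of \<open>N0\<close> compensates it.\<close>
    have "(\<Sum>n\<in>stage_vars V. stage_supply w WK n) = (\<Sum>n\<in>stage_vars V. - (stage_cost w WK n * 1))"
      by (rule sum.cong) (auto simp: stage_vars_def)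
    also have "\<dots> = - lp_objective P (\<lambda>_. 1)"
      by (simp add: lp_objective_def sum_negf)
    also have "\<dots> = - WK"
      by (simp add: stage_lp_objective[OF finV])
    finally show ?thesis
      using finV N0_notin by (simp add: verts_eq)
  qed
  have "(\<Sum>n\<in>verts G - {N0}. ?\<alpha> n * (stage_eq_lhs V E x n - stage_eq_rhs w WK n)) =
      (\<Sum>n\<in>verts G - {N0}. net x n - stage_supply w WK n)"
  proof (rule sum.cong)
    fix n
    assume "n \<in> verts G - {N0}"
    then show "?\<alpha> n * (stage_eq_lhs V E x n - stage_eq_rhs w WK n) = net x n - stage_supply w WK n"
      by (auto simp: verts_eq stage_vars_def net_NK net_NC net_ND net_NE simp del: stage_eq_lhs.simps)
  qed simp
  also have "\<dots> = - (net x N0 - stage_supply w WK N0)"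
    using total_supply sum_net[of x] finV N0_notin
    by (simp add: sum_subtractf verts_eq del: stage_supply.simps)
  finally show "stage_eq_lhs V E x N0 - stage_eq_rhs w WK N0 =
      (\<Sum>n\<in>verts G - {N0}. ?\<alpha> n * (stage_eq_lhs V E x n - stage_eq_rhs w WK n))"
    by (simp add: net_N0 del: stage_eq_lhs.simps)
qed

sublocale difference_lp P
proof
  show "finite (lp_vars P)"
    by (simp add: finV)
  show "lp_mat P = incidence"
    by (simp add: incidence_def)
  show "lp_rhs P r \<in> \<int>" for r
    by (cases "(ES, r)" rule: stage_rhs.cases) auto
qed

section \<open>Feasible points and bounded sublevel sets\<close>

lemma feasibleD:
  assumes "lp_feasible P y"
  shows "i \<in> source V E \<Longrightarrow> y (NC i) = 1" "i \<in> sink V E \<Longrightarrow> y (ND i) = y NK"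
    and "i \<in> V \<Longrightarrow> y (NC i) \<le> y (ND i)" "i \<in> V \<Longrightarrow> y (NC i) \<le> y (NE i)"
    and "i \<in> V \<Longrightarrow> y (NE i) \<le> y (NC i) + 1" "(i, j) \<in> E \<Longrightarrow> y (NC i) \<le> y (NC j)"
  using assms unfolding stage_lp_feasible_iff[OF finV E_sub] Let_def
  by (auto simp: algebra_simps of_bool_def split: if_splits)

text \<open>
  A feasible integral point: with \<open>a i\<close> the number of strict ancestors of \<open>i\<close>, take
  \<open>c i = 1 + a i\<close> and \<open>e i = 2 + a i\<close>.
\<close>

lemma ex_feasible_integral: "\<exists>y. lp_feasible P y \<and> lp_integral P y"
proof -
  define a where "a i = card {j. (j, i) \<in> E\<^sup>+}" for i
  have anc: "{j. (j, i) \<in> E\<^sup>+} \<subseteq> V" for i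
    using trancl_subset_Sigma[OF E_sub] by auto
  have a_le: "a i \<le> card V" for i
    unfolding a_def by (rule card_mono[OF finV anc])
  \<comment> \<open>Ancestors of \<open>i\<close> are ancestors of \<open>j\<close>, and
    \<open>i\<close> is an ancestor of \<open>j\<close> but, by acyclicity, not of itself.\<close>
  have a_less: "a i < a j" if "(i, j) \<in> E" for i j
  proof -
    have "i \<in> {k. (k, j) \<in> E\<^sup>+} - {k. (k, i) \<in> E\<^sup>+}"
      using that acyc by (auto simp: acyclic_def)
    moreover have "{k. (k, i) \<in> E\<^sup>+} \<subseteq> {k. (k, j) \<in> E\<^sup>+}"
      using that by (auto intro: trancl_into_trancl)
    ultimately show ?thesis
      unfolding a_def by (intro psubset_card_mono finite_subset[OF anc finV]) auto
  qed
  have a_source: "a i = 0" if "i \<in> source V E" for i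
  proof -
    have "{j. (j, i) \<in> E\<^sup>+} = {}"
      using that by (auto simp: source_def dest: tranclD2)
    then show ?thesis
      unfolding a_def by (simp only: card.empty)
  qed
  \<comment> \<open>\<open>1 + card V\<close> dominates every \<open>1 + a i\<close> and serves as
    \<open>K\<close> and as all discarding stages; the growth of \<open>a\<close> along edges gives
    the gap of 1 on swept edges.\<close>
  define y where "y v = (case v of N0 \<Rightarrow> 0 | NK \<Rightarrow> 1 + card V | NC i \<Rightarrow> 1 + a i | ND i \<Rightarrow> 1 + card V
    | NE i \<Rightarrow> 2 + a i)" for v
  have "lp_feasible P (\<lambda>v. real (y v))"
    unfolding stage_lp_feasible_iff[OF finV E_sub] Let_def
  proof (intro conjI ballI)
    fix r
    assume r: "r \<in> E"
    obtain i j where ij: "r = (i, j)"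
      by (cases r)
    have "a i < a j"
      using a_less r ij by simp
    then have "real (a i) + 1 \<le> real (a j)"
      by linarith
    then show "case r of (i, j) \<Rightarrow> real (y (NC i)) - real (y (NC j)) \<le> 0 \<and>
        real (y (NC j)) - real (y (ND i)) \<le> 0 \<and>
        real (y (NE i)) - real (y (NE j)) \<le> - of_bool ((i, j) \<in> ES)"
      using a_le[of j] by (auto simp: ij y_def)
  qed (use a_le a_source in \<open>auto simp: y_def\<close>)
  then show ?thesis
    by (auto simp: lp_integral_def)
qed

text \<open>Creating stages do not decrease along edges, and walking backwards ends at a source,
  where the value is 1.\<close>

lemma creating_ge_1:
  assumes "lp_feasible P y" "i \<in> V"
  shows "1 \<le> y (NC i)"
  using assms(2)
proof (induction i rule: wf_induct_rule[OF finite_acyclic_wf[OF finE acyc]])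
  case (1 i)
  show ?case
  proof (cases "i \<in> source V E")
    case False
    then obtain j where "(j, i) \<in> E"
      using 1 by (auto simp: source_def)
    then show ?thesis
      using 1(1)[of j] feasibleD(6)[OF assms(1)] E_sub by fastforce
  qed (simp add: feasibleD(1)[OF assms(1)])
qed

text \<open>Walking forwards ends at a sink, where \<open>c_i \<le> d_i = K\<close>.\<close>

lemma creating_le_K:
  assumes "lp_feasible P y" "i \<in> V"
  shows "y (NC i) \<le> y NK"
  using assms(2)
proof (induction i rule: wf_induct_rule[OF finite_acyclic_wf_converse[OF finE acyc]])
  case (1 i)
  show ?case
  proof (cases "i \<in> sink V E")
    case True
    then show ?thesis
      using feasibleD(2,3)[OF assms(1)] 1 by fastforce
  next
    case False
    then obtain j where "(i, j) \<in> E"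
      using 1 by (auto simp: sink_def)
    then show ?thesis
      using 1(1)[of j] feasibleD(6)[OF assms(1)] E_sub by fastforce
  qed
qed

text \<open>All terms of the objective are nonnegative, since \<open>K \<ge> 1\<close> by the
  existence of a vertex. Hence each is at most \<open>B\<close>, which bounds \<open>K\<close> and
  every \<open>d_i - c_i\<close>; \<open>c_i\<close> lies between 1 and \<open>K\<close>, and
  \<open>e_i\<close> exceeds it by at most 1.\<close>

lemma sublevel_bounded:
  assumes y: "lp_feasible P y" and B: "lp_objective P y \<le> B" and v: "v \<in> lp_vars P"
  shows "\<bar>y v\<bar> \<le> B / WK + (\<Sum>i\<in>V. B / w i) + 1"
proof -
  obtain i0 where "i0 \<in> V"
    using V_ne by blast
  then have K: "1 \<le> y NK"
    using creating_ge_1[OF y] creating_le_K[OF y] by fastforce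
  have terms: "0 \<le> w i * (y (ND i) - y (NC i))" if "i \<in> V" for i
    using that w_pos feasibleD(3)[OF y that] by (simp add: less_imp_le)
  have obj: "WK * y NK + (\<Sum>i\<in>V. w i * (y (ND i) - y (NC i))) \<le> B"
    using B by (simp add: stage_lp_objective[OF finV])
  have sum0: "0 \<le> (\<Sum>i\<in>V. w i * (y (ND i) - y (NC i)))"
    using terms by (rule sum_nonneg)
  have WK0: "0 \<le> WK * y NK"
    using WK_pos K by simp
  have B0: "0 \<le> B"
    using obj sum0 WK0 by linarith
  have "WK * y NK \<le> B"
    using obj sum0 by linarith
  then have KB: "y NK \<le> B / WK"
    using WK_pos by (simp add: field_simps)
  have sumB: "0 \<le> (\<Sum>i\<in>V. B / w i)"
    using B0 w_pos by (intro sum_nonneg) (simp add: less_imp_le)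
  have d: "y (ND i) - y (NC i) \<le> (\<Sum>i\<in>V. B / w i)" if i: "i \<in> V" for i
  proof -
    have "w i * (y (ND i) - y (NC i)) \<le> (\<Sum>i\<in>V. w i * (y (ND i) - y (NC i)))"
      using finV i terms by (intro member_le_sum) auto
    then have "w i * (y (ND i) - y (NC i)) \<le> B"
      using obj WK0 by linarith
    then have "y (ND i) - y (NC i) \<le> B / w i"
      using w_pos[OF i] by (simp add: field_simps)
    also have "\<dots> \<le> (\<Sum>i\<in>V. B / w i)"
      using finV i w_pos B0 by (intro member_le_sum) (auto simp: less_imp_le)
    finally show ?thesis .
  qed
  consider "v = NK" | i where "i \<in> V" "v = NC i \<or> v = ND i \<or> v = NE i"
    using v by (auto simp: stage_vars_def)
  then show ?thesis
  proof cases
    case 1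
    then show ?thesis
      using K KB sumB by simp
  next
    case (2 i)
    then show ?thesis
      using creating_ge_1[OF y, of i] creating_le_K[OF y, of i] feasibleD(3-5)[OF y, of i]
        d[of i] KB sumB by auto
  qed
qed

lemma ex_basic_optimal_stage: "\<exists>y. lp_basic P y \<and> lp_optimal P y"
proof -
  obtain y0 where "lp_feasible P y0" "lp_integral P y0"
    using ex_feasible_integral by blast
  then show ?thesis
    by (rule ex_basic_optimal) (rule sublevel_bounded)
qed

end

theorem mainTheorem2:
  fixes V :: "'v set" and E ES :: "('v \<times> 'v) set" and w :: "'v \<Rightarrow> real" and WK :: real
  assumes "finite V" and "V \<noteq> {}" and "E \<subseteq> V \<times> V" and "acyclic E" and "ES \<subseteq> E"
    and "\<forall>i\<in>V. 0 < w i" and "0 < WK"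
  shows
    "let P = stage_lp V E ES w WK; G = stage_network V E in
      (totally_unimodular (lp_ineqs P \<union> lp_eqs P) (lp_vars P) (lp_mat P) \<and>
       (\<exists>y. lp_basic P y \<and> lp_optimal P y) \<and>
       (\<forall>y. lp_basic P y \<and> lp_optimal P y \<longrightarrow> lp_integral P y \<and> ip_optimal P y))
      \<and>
      (\<forall>x. (lp_dual_feasible P x \<longleftrightarrow> stage_dual_feasible V E w WK x) \<and>
           lp_dual_objective P x = stage_dual_objective V E ES x)
      \<and>
      ((\<exists>\<alpha>. \<forall>x. stage_eq_lhs V E x N0 - stage_eq_rhs w WK N0 =
          (\<Sum>n\<in>verts G - {N0}. \<alpha> n * (stage_eq_lhs V E x n - stage_eq_rhs w WK n))) \<and>
       fin_digraph G \<and>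
       (\<forall>x. \<forall>n\<in>verts G. stage_eq_lhs V E x n = stage_eq_rhs w WK n \<longleftrightarrow>
          flow_balance G (stage_supply w WK) x n) \<and>
       (\<forall>x. (stage_dual_feasible V E w WK x \<and> stage_eq_lhs V E x N0 = stage_eq_rhs w WK N0 \<longleftrightarrow>
             flow_feasible G (stage_supply w WK) (stage_eqs V E) x) \<and>
            stage_dual_objective V E ES x = flow_cost G (stage_rhs ES) x))"
proof -
  interpret stage V E ES w WK
    using assms by unfold_locales auto
  have "totally_unimodular (lp_ineqs P \<union> lp_eqs P) (lp_vars P) (lp_mat P)"
    unfolding mat by (rule totally_unimodular_incidence)
  \<comment> \<open>An integral optimum of the relaxation is optimal among the integral points,
    which are fewer.\<close>
  moreover have "lp_integral P y \<and> ip_optimal P y" if "lp_basic P y" "lp_optimal P y" for y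
    using basic_integral[OF that(1)] that(2) by (auto simp: ip_optimal_def lp_optimal_def)
  ultimately show ?thesis
    unfolding Let_def
    using ex_basic_optimal_stage lp_dual_feasible_iff dual_objective N0_combination
      fin_digraph_network net_eq_iff flow_balance_iff flow_feasible_iff dual_objective_flow_cost
    by (intro conjI) blast+
qed

end
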